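(* Let $\Gamma=\mathbb{O}$ be the group of order $24$ (rotational symmetries of the cube) generated by $$C=\begin{bmatrix}0&1&0\\0&0&1\\1&0&0\end{bmatrix},\quad T=\begin{bmatrix}0&1&0\\-1&0&0\\0&0&1\end{bmatrix},$$ acting on $\mathbb{C}^3\cong\mathbb{R}^6$ by these matrices. Then, up to conjugacy in $\Gamma$, all pairs of subgroups $K\subseteq H\subseteq\Gamma$ with $H\neq\mathbf{1}$ that satisfy the conditions (a)–(d) of the $H \bmod K$ theorem occur as spatio-temporal symmetries $H$ and spatial symmetries $K$ of periodic solutions arising through a primary Hopf bifurcation, except for the following three pairs, which do not occur: (1) $H=K=\mathbb{Z}_4$, generated by $TC^2$; (2) $H=K=\mathbb{Z}_3$, generated by $C$; (3) $H=K=\mathbb{Z}_2$, generated by $T^3C^2$.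
   Context: Notation: $\mathbf{1}$ is the trivial subgroup; $\mathrm{Fix}(\Sigma)$ is the subspace of points fixed by every element of $\Sigma$; an isotropy subgroup of $\Gamma$ is the stabiliser of some point of $\mathbb{R}^6$; $N(K)$ is the normaliser of $K$ in $\Gamma$. All dimensions are real. Conditions of the $H \bmod K$ theorem for a pair of subgroups $K\subseteq H$ of a finite group $\Gamma$ acting on $\mathbb{R}^n$ ($K$ normal in $H$): (a) $H/K$ is cyclic; (b) $K$ is an isotropy subgroup; (c) $\dim\mathrm{Fix}(K)\ge 2$, and if $\dim\mathrm{Fix}(K)=2$ then either $H=K$ or $H=N(K)$; (d) $H$ fixes (maps to itself) a connected component of $\mathrm{Fix}(K)\setminus L_K$, where $L_K=\bigcup_{\delta\in\Gamma,\ \delta\notin K}\mathrm{Fix}(\delta)\cap\mathrm{Fix}(K)$. Symmetries of a periodic solution: for a periodic solution $x(t)$ of a $\Gamma$-equivariant ODE, the group of spatial symmetries is $K=\{\delta\in\Gamma:\delta x(t)=x(t)\ \forall t\}$ and the group of spatio-temporal symmetries is $H=\{\delta\in\Gamma:\delta\{x(t)\}=\{x(t)\}\}$, where $\{x(t)\}$ is the trajectory as a set. Primary Hopf bifurcation means Hopf bifurcation from the trivial equilibrium (the origin), in the setting of the equivariant Hopf theorem: $\dot x=f(x,\lambda)$ with $f:\mathbb{R}^6\times\mathbb{R}\to\mathbb{R}^6$ smooth and $\Gamma$-equivariant in $x$, so that $f(0,\lambda)=0$; $(df)_{0,\lambda}$ has eigenvalues $\sigma(\lambda)\pm i\rho(\lambda)$,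 each of multiplicity $3$, with $\sigma(0)=0$, $\rho(0)=1$, $\sigma'(0)\neq0$. A pair $(H,K)$ occurs at a primary Hopf bifurcation if for some such family there is a branch of periodic solutions with symmetry groups $H$ and $K$ that bifurcates from the origin at $\lambda=0$, with amplitude tending to $0$ and period tending to $2\pi$ as $\lambda\to0$ along the branch (branches with four-dimensional fixed-point space for their symmetry group in $\Gamma\times\mathbb{S}^1$ are allowed; here $\theta\in\mathbb{S}^1$ acts on $\mathbb{C}^3$ as multiplication by $e^{i\theta}$). *)

theory Defs
  imports
    "HOL-Analysis.Analysis"
    "HOL-Computational_Algebra.Polynomial"
    "HOL-Algebra.Group_Action"
    "HOL-Algebra.Elementary_Groups"
begin

section \<open>The octahedral group acting on complex three-space\<close>

definition GL3 :: "(complex^3^3) monoid" where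
  "GL3 = \<lparr>carrier = {A. invertible A}, mult = (**), one = mat 1\<rparr>"

definition C_mat :: "complex^3^3" where
  "C_mat = vector [vector [0, 1, 0], vector [0, 0, 1], vector [1, 0, 0]]"

definition T_mat :: "complex^3^3" where
  "T_mat = vector [vector [0, 1, 0], vector [-1, 0, 0], vector [0, 0, 1]]"

definition octahedral_group :: "(complex^3^3) monoid" where
  "octahedral_group = GL3\<lparr>carrier := generate GL3 {C_mat, T_mat}\<rparr>"


section \<open>The conditions of the H mod K theorem\<close>

text \<open>Throughout, a group \<open>G\<close> acts on a real Euclidean space by \<open>\<phi>\<close>; the dimension
  \<^const>\<open>dim\<close> is the real one, also for the space \<^typ>\<open>complex^3\<close>.\<close>

definition fix_space :: "('g \<Rightarrow> 'v \<Rightarrow> 'v) \<Rightarrow> 'g set \<Rightarrow> 'v set" where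
  "fix_space \<phi> S = {x. \<forall>g\<in>S. \<phi> g x = x}"

definition isotropy_subgroup :: "('g, 'm) monoid_scheme \<Rightarrow> ('g \<Rightarrow> 'v \<Rightarrow> 'v) \<Rightarrow> 'g set \<Rightarrow> bool" where
  "isotropy_subgroup G \<phi> K \<longleftrightarrow> (\<exists>x. K = stabilizer G \<phi> x)"

definition L_set :: "('g, 'm) monoid_scheme \<Rightarrow> ('g \<Rightarrow> 'v \<Rightarrow> 'v) \<Rightarrow> 'g set \<Rightarrow> 'v set" where
  "L_set G \<phi> K = (\<Union>\<delta>\<in>carrier G - K. fix_space \<phi> {\<delta>} \<inter> fix_space \<phi> K)"

definition H_mod_K_conditions ::
    "('g, 'm) monoid_scheme \<Rightarrow> ('g \<Rightarrow> 'v::euclidean_space \<Rightarrow> 'v) \<Rightarrow> 'g set \<Rightarrow> 'g set \<Rightarrow> bool" where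
  "H_mod_K_conditions G \<phi> H K \<longleftrightarrow>
     subgroup H G \<and> K \<lhd> G\<lparr>carrier := H\<rparr> \<and>
     cyclic_group (G\<lparr>carrier := H\<rparr> Mod K) \<and>
     isotropy_subgroup G \<phi> K \<and>
     2 \<le> dim (fix_space \<phi> K) \<and>
     (dim (fix_space \<phi> K) = 2 \<longrightarrow> H = K \<or> H = normalizer G K) \<and>
     (\<exists>V\<in>components (fix_space \<phi> K - L_set G \<phi> K). \<forall>h\<in>H. \<phi> h ` V = V)"

definition conjugate_pairs ::
    "('g, 'm) monoid_scheme \<Rightarrow> 'g set \<Rightarrow> 'g set \<Rightarrow> 'g set \<Rightarrow> 'g set \<Rightarrow> bool" where
  "conjugate_pairs G H K H' K' \<longleftrightarrow>
     (\<exists>g\<in>carrier G. H' = g <#\<^bsub>G\<^esub> H #>\<^bsub>G\<^esub> inv\<^bsub>G\<^esub> g \<and> K' = g <#\<^bsub>G\<^esub> K #>\<^bsub>G\<^esub> inv\<^bsub>G\<^esub> g)"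


section \<open>Periodic solutions and their symmetries\<close>

text \<open>The period \<open>P\<close> is the minimal one; in particular equilibria are excluded.\<close>

definition periodic_solution :: "('v::euclidean_space \<Rightarrow> 'v) \<Rightarrow> (real \<Rightarrow> 'v) \<Rightarrow> real \<Rightarrow> bool" where
  "periodic_solution F x P \<longleftrightarrow>
     (\<forall>t. (x has_vector_derivative F (x t)) (at t)) \<and>
     0 < P \<and> (\<forall>t. x (t + P) = x t) \<and>
     (\<forall>Q. 0 < Q \<and> Q < P \<longrightarrow> (\<exists>t. x (t + Q) \<noteq> x t))"

definition spatial_symmetries ::
    "('g, 'm) monoid_scheme \<Rightarrow> ('g \<Rightarrow> 'v \<Rightarrow> 'v) \<Rightarrow> (real \<Rightarrow> 'v) \<Rightarrow> 'g set" where
  "spatial_symmetries G \<phi> x = {\<delta>\<in>carrier G. \<forall>t. \<phi> \<delta> (x t) = x t}"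

definition spatiotemporal_symmetries ::
    "('g, 'm) monoid_scheme \<Rightarrow> ('g \<Rightarrow> 'v \<Rightarrow> 'v) \<Rightarrow> (real \<Rightarrow> 'v) \<Rightarrow> 'g set" where
  "spatiotemporal_symmetries G \<phi> x = {\<delta>\<in>carrier G. \<phi> \<delta> ` range x = range x}"


section \<open>Smooth maps and eigenvalue multiplicities\<close>

fun Ck_map :: "nat \<Rightarrow> ('a::real_normed_vector \<Rightarrow> 'b::real_normed_vector) \<Rightarrow> bool" where
  "Ck_map 0 f \<longleftrightarrow> continuous_on UNIV f"
| "Ck_map (Suc k) f \<longleftrightarrow>
     (\<forall>x. f differentiable (at x)) \<and> (\<forall>v. Ck_map k (\<lambda>x. frechet_derivative f (at x) v))"

definition smooth_map :: "('a::real_normed_vector \<Rightarrow> 'b::real_normed_vector) \<Rightarrow> bool" where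
  "smooth_map f \<longleftrightarrow> (\<forall>k. Ck_map k f)"

text \<open>A real-linear endomorphism of \<^typ>\<open>complex^'n\<close> need not be complex-linear, so its
  eigenvalues are those of its matrix with respect to real coordinates: \<open>Inl j\<close> indexes the
  real part and \<open>Inr j\<close> the imaginary part of the \<open>j\<close>-th component.\<close>

definition real_coords :: "complex^'n \<Rightarrow> real^('n + 'n)" where
  "real_coords z = (\<chi> k. case k of Inl j \<Rightarrow> Re (z $ j) | Inr j \<Rightarrow> Im (z $ j))"

definition of_real_coords :: "real^('n + 'n) \<Rightarrow> complex^'n" where
  "of_real_coords w = (\<chi> j. Complex (w $ Inl j) (w $ Inr j))"

definition real_matrix :: "(complex^'n \<Rightarrow> complex^'n) \<Rightarrow> real^('n + 'n)^('n + 'n)" where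
  "real_matrix L = matrix (real_coords \<circ> L \<circ> of_real_coords)"

definition charpoly :: "'a::comm_ring_1^'n^'n \<Rightarrow> 'a poly" where
  "charpoly A = det (mat [:0, 1:] - map_matrix (\<lambda>a. [:a:]) A)"

definition eigenvalue_multiplicity :: "(complex^'n \<Rightarrow> complex^'n) \<Rightarrow> complex \<Rightarrow> nat" where
  "eigenvalue_multiplicity L \<mu> =
     Polynomial.order \<mu> (charpoly (map_matrix complex_of_real (real_matrix L)))"


section \<open>Primary Hopf bifurcation\<close>

definition hopf_family ::
    "('g, 'm) monoid_scheme \<Rightarrow> ('g \<Rightarrow> complex^3 \<Rightarrow> complex^3) \<Rightarrow>
     ((complex^3) \<times> real \<Rightarrow> complex^3) \<Rightarrow> bool" where
  "hopf_family G \<phi> f \<longleftrightarrow>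
     smooth_map f \<and>
     (\<forall>g\<in>carrier G. \<forall>x lam. f (\<phi> g x, lam) = \<phi> g (f (x, lam))) \<and>
     (\<forall>lam. f (0, lam) = 0) \<and>
     (\<exists>\<sigma> \<rho> :: real \<Rightarrow> real.
        (\<forall>lam. let L = frechet_derivative (\<lambda>x. f (x, lam)) (at 0) in
           eigenvalue_multiplicity L (Complex (\<sigma> lam) (\<rho> lam)) = 3 \<and>
           eigenvalue_multiplicity L (Complex (\<sigma> lam) (- \<rho> lam)) = 3) \<and>
        \<sigma> 0 = 0 \<and> \<rho> 0 = 1 \<and>
        (\<exists>d. (\<sigma> has_real_derivative d) (at 0) \<and> d \<noteq> 0))"

text \<open>A branch is a continuous curve, indexed by \<open>s\<close> in \<open>(0, 1]\<close>, of parameter values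
  \<open>\<Lambda> s\<close> and periodic solutions \<open>x s\<close> with period \<open>P s\<close>. As \<open>\<Lambda>\<close> is continuous and does not
  vanish on \<open>(0, 1]\<close>, the parameter can tend to 0 along the branch only as \<open>s\<close> tends to 0.\<close>

definition hopf_branch ::
    "((complex^3) \<times> real \<Rightarrow> complex^3) \<Rightarrow>
     (real \<Rightarrow> real) \<Rightarrow> (real \<Rightarrow> real \<Rightarrow> complex^3) \<Rightarrow> (real \<Rightarrow> real) \<Rightarrow> bool" where
  "hopf_branch f \<Lambda> x P \<longleftrightarrow>
     continuous_on {0<..1} \<Lambda> \<and> continuous_on {0<..1} P \<and>
     continuous_on ({0<..1} \<times> UNIV) (\<lambda>(s, t). x s t) \<and>
     (\<forall>s\<in>{0<..1}. \<Lambda> s \<noteq> 0 \<and> periodic_solution (\<lambda>y. f (y, \<Lambda> s)) (x s) (P s)) \<and>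
     (\<Lambda> \<longlongrightarrow> 0) (at_right 0) \<and>
     ((\<lambda>s. SUP t. norm (x s t)) \<longlongrightarrow> 0) (at_right 0) \<and>
     (P \<longlongrightarrow> 2 * pi) (at_right 0)"

definition occurs_at_primary_hopf ::
    "('g, 'm) monoid_scheme \<Rightarrow> ('g \<Rightarrow> complex^3 \<Rightarrow> complex^3) \<Rightarrow> 'g set \<Rightarrow> 'g set \<Rightarrow> bool" where
  "occurs_at_primary_hopf G \<phi> H K \<longleftrightarrow>
     (\<exists>f \<Lambda> x P. hopf_family G \<phi> f \<and> hopf_branch f \<Lambda> x P \<and>
        (\<forall>s\<in>{0<..1}. spatiotemporal_symmetries G \<phi> (x s) = H \<and>
                      spatial_symmetries G \<phi> (x s) = K))"

end

theory Submission
  imports Defs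
begin

text \<open>
  Existence: the family \<open>z' = (\<lambda> + \<i>) z - |z|\<^sup>2 z\<close> is equivariant under all unitary maps, so every
  complex direction \<open>v\<close> carries the circular solutions \<open>s e\<^sup>i\<^sup>t v\<close>; their spatial symmetries are the
  stabiliser of \<open>v\<close>, their spatio-temporal symmetries the elements that move \<open>v\<close> by a phase. If
  \<open>Fix K\<close> is a complex line spanned by \<open>w\<close>, the choice \<open>v = w\<close> gives the pair of the normaliser of
  \<open>K\<close> and \<open>K\<close>. If \<open>K\<close> is trivial, \<open>H\<close> is cyclic, and a suitable \<open>v\<close> in the complexified plane
  orthogonal to its axis works.

  Non-existence: the remaining pairs have \<open>H = K\<close> with \<open>Fix K\<close> a complex line on which some element
  of the group acts as \<open>-1\<close>. The linearisation restricted to this real plane squares to \<open>-1\<close>, so a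
  small periodic solution rotates around the origin, and comparing radii at opposite angles shows
  that it meets its own antipode. By uniqueness of solutions its trajectory is invariant under
  \<open>-1\<close>, hence \<open>H \<noteq> K\<close>.
\<close>

section \<open>Rotating periodic orbits\<close>

text \<open>The obstacle in the non-existence half is that the linearisation need not be complex
  linear. The group acts by real matrices, so a commuting map of C^3, seen as R^3 tensor R^2, is an
  arbitrary real 2 by 2 matrix \<open>m\<close> applied to every coordinate. The orbit can be
  compared with a rotation only after a real change of coordinates that turns \<open>m\<close> into
  multiplication by \<open>\<i>\<close>. No reduction to a normal form is made: it suffices that the
  field is close to its linearisation in the Lipschitz sense. That there are three exceptions comes
  from the geometry of the cube. There are four classes of nontrivial rotations, each with a complex
  line as fixed space, and every axis is reversed by some rotation. The half turn about a face axis
  gives no exception of its own, because the quarter turns fix the same line, so the group that it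
  generates is not an isotropy subgroup.\<close>

text \<open>Gronwall in both time directions: exp (- 2 L t) |d|^2 does not increase and exp (2 L t)
  |d|^2 does not decrease, so the zero at \<open>t0\<close> spreads forwards by the first and
  backwards by the second.\<close>

lemma linear_growth_zero:
  fixes d :: "real \<Rightarrow> 'a::real_inner"
  assumes d: "\<And>t. (d has_vector_derivative d' t) (at t)"
    and le: "\<And>t. norm (d' t) \<le> L * norm (d t)"
    and zero: "d t0 = 0"
  shows "d t = 0"
proof -
  have L: "2 * \<bar>d t \<bullet> d' t\<bar> \<le> 2 * L * (d t \<bullet> d t)" for t
  proof -
    have "\<bar>d t \<bullet> d' t\<bar> \<le> norm (d t) * norm (d' t)"
      by (rule Cauchy_Schwarz_ineq2)
    also have "\<dots> \<le> norm (d t) * (L * norm (d t))"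
      by (intro mult_left_mono le) simp
    also have "\<dots> = L * (d t \<bullet> d t)"
      by (simp add: power2_norm_eq_inner[symmetric] power2_eq_square)
    finally show ?thesis by simp
  qed
  have der: "((\<lambda>t. d t \<bullet> d t) has_real_derivative 2 * (d t \<bullet> d' t)) (at t)" for t
    using has_derivative_inner[OF d[of t, unfolded has_vector_derivative_def] d[of t, unfolded has_vector_derivative_def]]
    by (auto simp: has_field_derivative_def inner_commute elim!: has_derivative_eq_rhs)
  define E where "E c t = exp (c * t) * (d t \<bullet> d t)" for c t
  have dE: "(E c has_real_derivative exp (c*t) * (c * (d t \<bullet> d t) + 2 * (d t \<bullet> d' t))) (at t)" for c t
    unfolding E_def by (rule derivative_eq_intros der refl | simp add: algebra_simps)+
  have "d t \<bullet> d t \<le> 0"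
  proof (cases "t0 \<le> t")
    case True
    have "E (-2*L) t \<le> E (-2*L) t0"
    proof (rule DERIV_nonpos_imp_nonincreasing[OF True])
      fix s
      have "exp (-2 * L * s) * ((-2*L) * (d s \<bullet> d s) + 2 * (d s \<bullet> d' s)) \<le> 0"
        using L[of s] by (intro mult_nonneg_nonpos) auto
      then show "\<exists>y. (E (-2*L) has_real_derivative y) (at s) \<and> y \<le> 0"
        using dE by blast
    qed
    then show ?thesis by (simp add: E_def zero mult_le_0_iff)
  next
    case False
    then have "t \<le> t0" by simp
    then have "E (2*L) t \<le> E (2*L) t0"
    proof (rule DERIV_nonneg_imp_nondecreasing)
      fix s
      have "0 \<le> exp (2 * L * s) * (2*L * (d s \<bullet> d s) + 2 * (d s \<bullet> d' s))"
        using L[of s] by (intro mult_nonneg_nonneg) auto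
      then show "\<exists>y. (E (2*L) has_real_derivative y) (at s) \<and> 0 \<le> y"
        using dE by blast
    qed
    then show ?thesis by (simp add: E_def zero mult_le_0_iff)
  qed
  then show ?thesis by (metis inner_eq_zero_iff inner_ge_zero order_antisym)
qed

text \<open>For \<open>s\<close> near \<open>t\<close> continuity keeps the imaginary part of
  \<open>g s - g t\<close> below \<pi> in modulus, so there the lift agrees with
  \<open>g t + Ln (p s / p t)\<close>, and the principal logarithm is differentiable at 1.\<close>

lemma continuous_lift_has_vector_derivative:
  fixes p g :: "real \<Rightarrow> complex"
  assumes p: "(p has_vector_derivative p') (at t)"
    and g: "continuous_on UNIV g" and pg: "\<And>t. p t = exp (g t)"
  shows "(g has_vector_derivative p' / p t) (at t)"
proof -
  have "isCont g t" using g by (simp add: continuous_on_eq_continuous_at)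
  then have "eventually (\<lambda>s. dist (g s) (g t) < pi) (at t)"
    by (metis pi_gt_zero isCont_def tendstoD)
  then have ev: "eventually (\<lambda>s. g t + Ln (p s / p t) = g s) (at t)"
  proof eventually_elim
    case (elim s)
    have "\<bar>Im (g s - g t)\<bar> < pi"
      using elim abs_Im_le_cmod[of "g s - g t"] by (simp add: dist_norm)
    then have "Ln (exp (g s - g t)) = g s - g t"
      by (intro Ln_exp) auto
    then show ?case by (simp add: pg exp_diff)
  qed
  have der: "((\<lambda>s. g t + Ln (p s / p t)) has_vector_derivative p' / p t) (at t)"
  proof -
    have "((\<lambda>s. p s / p t) has_vector_derivative p' / p t) (at t)"
      using p by (rule has_vector_derivative_divide)
    moreover have "(Ln has_field_derivative 1) (at (p t / p t))"
      using has_field_derivative_Ln[of "1::complex"] by (simp add: pg)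
    ultimately have "(Ln \<circ> (\<lambda>s. p s / p t) has_vector_derivative p' / p t * 1) (at t)"
      by (rule field_vector_diff_chain_at)
    then show ?thesis
      by (simp add: o_def has_vector_derivative_add_const add.commute[of "g t"])
  qed
  have "g t + Ln (p t / p t) = g t" by (simp add: pg)
  from has_derivative_transform_eventually[OF der[unfolded has_vector_derivative_def] ev this]
  show ?thesis by (simp add: has_vector_derivative_def)
qed

text \<open>In logarithmic coordinates \<open>p = exp (R + \<i> a)\<close>, parametrised by the angle \<open>a\<close>, the radial
  part \<open>R\<close> is periodic with period \<open>2 k \<pi>\<close> for some \<open>k\<close>, so \<open>R (a + \<pi>) - R a\<close> cannot have
  constant sign.\<close>

lemma rotating_periodic_meets_antipode:
  fixes p :: "real \<Rightarrow> complex"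
  assumes p: "\<And>t. (p has_vector_derivative p' t) (at t)"
    and rot: "\<And>t. norm (p' t - \<i> * p t) \<le> norm (p t) / 2"
    and P: "0 < P" "\<And>t. p (t + P) = p t"
    and nz: "\<And>t. p t \<noteq> 0"
  shows "\<exists>t t'. p t' = - p t"
proof -
  have "continuous_on UNIV p"
    using p by (meson continuous_at_imp_continuous_on has_vector_derivative_continuous)
  then obtain g where g: "continuous_on UNIV g" and pg: "\<And>t. p t = exp (g t)"
    using continuous_logarithm_on_contractible[of UNIV p] nz convex_imp_contractible[OF convex_UNIV]
    by (metis UNIV_I)
  have dg: "(g has_vector_derivative p' t / p t) (at t)" for t
    by (rule continuous_lift_has_vector_derivative[OF p g pg])
  define \<theta> where "\<theta> t = Im (g t)" for t
  have d\<theta>: "(\<theta> has_real_derivative Im (p' t / p t)) (at t)" for t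
    unfolding \<theta>_def using dg[of t] 
    by (simp add: has_real_derivative_iff_has_vector_derivative bounded_linear.has_vector_derivative[OF bounded_linear_Im])
  \<comment> \<open>The angular speed is the imaginary part of p' / p, and p' / p lies within 1/2 of
    \<open>\<i>\<close>.\<close>
  have speed: "1/2 \<le> Im (p' t / p t)" for t
  proof -
    have "p' t / p t - \<i> = (p' t - \<i> * p t) / p t" using nz by (simp add: field_simps)
    then have "norm (p' t / p t - \<i>) \<le> 1/2"
      using rot[of t] nz[of t] by (simp add: norm_divide field_simps)
    then show ?thesis using abs_Im_le_cmod[of "p' t / p t - \<i>"] by simp
  qed
  have grow: "(t - s) / 2 \<le> \<theta> t - \<theta> s" if "s \<le> t" for s t
  proof -
    have "\<theta> s - s/2 \<le> \<theta> t - t/2"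
    proof (rule DERIV_nonneg_imp_nondecreasing[OF that])
      fix u
      have "((\<lambda>u. \<theta> u - u/2) has_real_derivative Im (p' u / p u) - 1/2) (at u)"
        by (rule derivative_eq_intros d\<theta> refl | simp)+
      then show "\<exists>y. ((\<lambda>u. \<theta> u - u/2) has_real_derivative y) (at u) \<and> 0 \<le> y"
        using speed[of u] by fastforce
    qed
    then show ?thesis by simp
  qed
  have cont\<theta>: "isCont \<theta> t" for t using d\<theta> DERIV_isCont by blast
  have "\<exists>t. \<theta> t = a" for a
  proof -
    define N where "N = 2 * \<bar>a - \<theta> 0\<bar>"
    have "0 \<le> N" "\<theta> (-N) \<le> a" "a \<le> \<theta> N"
      using grow[of 0 N] grow[of "-N" 0] by (auto simp: N_def)
    then show ?thesis using IVT[of \<theta> "-N" a N] cont\<theta> by auto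
  qed
  then obtain \<tau> where \<tau>: "\<And>a. \<theta> (\<tau> a) = a" by metis
  have inj: "s = t" if "\<theta> s = \<theta> t" for s t
  proof (rule linorder_cases[of s t])
    assume "s < t" then show ?thesis using grow[of s t] that by simp
  next
    assume "t < s" then show ?thesis using grow[of t s] that by simp
  qed
  \<comment> \<open>\<open>\<tau>\<close> inverts the angle, so the lower bound 1/2 on the angular
    speed becomes the Lipschitz constant 2.\<close>
  have "2-lipschitz_on UNIV \<tau>"
  proof (rule lipschitz_onI)
    fix a b
    show "dist (\<tau> a) (\<tau> b) \<le> 2 * dist a b"
    proof (cases "\<tau> a \<le> \<tau> b")
      case True
      then show ?thesis using grow[OF True] by (simp add: dist_real_def \<tau>)
    next
      case False
      then have "\<tau> b \<le> \<tau> a" by simp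
      from grow[OF this] show ?thesis using False by (simp add: dist_real_def \<tau>)
    qed
  qed simp
  then have cont\<tau>: "continuous_on UNIV \<tau>" by (rule lipschitz_on_continuous_on)
  define R where "R a = Re (g (\<tau> a))" for a
  have p\<tau>: "p (\<tau> a) = exp (R a) * cis a" for a
    unfolding pg R_def using \<tau>[of a] by (simp add: exp_eq_polar \<theta>_def)
  define d where "d a = R (a + pi) - R a" for a
  have contR: "continuous_on UNIV R" unfolding R_def
    by (intro continuous_intros continuous_on_compose2[OF g] cont\<tau>) auto
  have contd: "isCont d a" for a
  proof -
    have "continuous_on UNIV d" unfolding d_def
      by (intro continuous_intros continuous_on_compose2[OF contR]) auto
    then show ?thesis by (simp add: continuous_on_eq_continuous_at)
  qed
  \<comment> \<open>Over one period the lift gains a multiple of 2 \<pi> \<i>: the angle advances by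
    \<open>k\<close> half turns, \<open>k\<close> positive and even, while the radial part returns
    to its value.\<close>
  have "exp (g P) = exp (g 0)" using P(2)[of 0] pg by simp
  then obtain n :: int where n: "g P = g 0 + (2 * of_int n * pi) * \<i>"
    unfolding exp_eq by auto
  have \<theta>P: "\<theta> P = \<theta> 0 + 2 * of_int n * pi" by (simp add: \<theta>_def n)
  have "0 < \<theta> P - \<theta> 0" using grow[of 0 P] P by simp
  then have "n > 0" using \<theta>P by (simp add: zero_less_mult_iff)
  define k where "k = 2 * nat n"
  have k: "real k = 2 * of_int n" "k > 0" using \<open>n > 0\<close> by (auto simp: k_def)
  have "\<tau> (\<theta> 0) = 0" "\<tau> (\<theta> 0 + real k * pi) = P"
    using \<tau>[of "\<theta> 0"] \<tau>[of "\<theta> P"] inj \<theta>P k by auto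
  then have Rper: "R (\<theta> 0 + real k * pi) = R (\<theta> 0)" by (simp add: R_def n)
  have tele: "(\<Sum>j<k. d (\<theta> 0 + real j * pi)) = 0"
  proof -
    have "(\<Sum>j<k. R (\<theta> 0 + real (Suc j) * pi) - R (\<theta> 0 + real j * pi)) = R (\<theta> 0 + real k * pi) - R (\<theta> 0 + real 0 * pi)"
      by (rule sum_lessThan_telescope)
    then show ?thesis using Rper by (simp add: d_def algebra_simps)
  qed
  have "\<exists>a. d a = 0"
  proof (rule ccontr)
    assume no: "\<nexists>a. d a = 0"
    have same: "d a > 0" if "d b > 0" for a b
    proof (rule ccontr)
      assume "\<not> d a > 0"
      then have "d a \<le> 0" by simp
      then have "\<exists>c. d c = 0"
        using IVT[of d a 0 b] IVT2[of d a 0 b] that contd by (cases "a \<le> b") auto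
      with no show False ..
    qed
    show False
    proof (cases "\<exists>b. d b > 0")
      case True
      then have "(\<Sum>j<k. d (\<theta> 0 + real j * pi)) > 0"
        using same k by (intro sum_pos) auto
      then show False using tele by simp
    next
      case False
      then have "- d a > 0" for a using no by (metis neg_0_less_iff_less not_less_iff_gr_or_eq)
      then have "(\<Sum>j<k. - d (\<theta> 0 + real j * pi)) > 0"
        using k by (intro sum_pos) auto
      then show False using tele by (simp add: sum_negf)
    qed
  qed
  then obtain a where "R (a + pi) = R a" by (auto simp: d_def)
  then have "p (\<tau> (a + pi)) = - p (\<tau> a)" by (simp add: p\<tau> cis_mult[symmetric])
  then show ?thesis by blast
qed

section \<open>Eigenvalue multiplicities\<close>

lemma poly_det: "poly (det M) \<mu> = det (map_matrix (\<lambda>p. poly p \<mu>) M)"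
  by (simp add: det_def poly_sum poly_prod map_matrix_def)

lemma poly_charpoly: "poly (charpoly A) \<mu> = det (mat \<mu> - A)"
  unfolding charpoly_def poly_det
  by (rule arg_cong[where f = det]) (auto simp: vec_eq_iff mat_def map_matrix_def)

lemma eigenvector_if_multiplicity:
  assumes "eigenvalue_multiplicity L \<mu> \<noteq> 0"
  obtains W where "W \<noteq> 0" "map_matrix complex_of_real (real_matrix L) *v W = \<mu> *s W"
proof -
  let ?A = "map_matrix complex_of_real (real_matrix L)"
  have "poly (charpoly ?A) \<mu> = 0"
    using assms by (simp add: eigenvalue_multiplicity_def order_root)
  then have "\<not> invertible (mat \<mu> - ?A)"
    by (simp add: poly_charpoly invertible_det_nz)
  then obtain W where W: "W \<noteq> 0" "(mat \<mu> - ?A) *v W = 0"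
    by (metis invertible_left_inverse matrix_left_invertible_ker)
  have "mat \<mu> *v W = \<mu> *s W"
    by (simp add: vec_eq_iff matrix_vector_mult_def mat_def if_distrib[of "\<lambda>a. a * _"] sum.delta cong: if_cong)
  with W show thesis by (intro that[of W]) (auto simp: matrix_vector_mult_diff_rdistrib)
qed

lemma real_coords_of_real_coords [simp]: "real_coords (of_real_coords w) = w"
  by (auto simp: real_coords_def of_real_coords_def vec_eq_iff split: sum.split)

lemma of_real_coords_real_coords [simp]: "of_real_coords (real_coords w) = w"
  by (auto simp: real_coords_def of_real_coords_def vec_eq_iff)

lemma linear_of_real_coords: "linear of_real_coords"
  by (rule linearI) (auto simp: of_real_coords_def vec_eq_iff complex_eq_iff)

lemma linear_real_coords: "linear real_coords"
  by (rule linearI) (auto simp: real_coords_def vec_eq_iff split: sum.split)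

lemma real_matrix_works:
  assumes "linear L"
  shows "real_matrix L *v w = real_coords (L (of_real_coords w))"
  using matrix_works[of "real_coords \<circ> L \<circ> of_real_coords" w]
    linear_compose[OF linear_compose[OF linear_of_real_coords assms] linear_real_coords]
  by (simp add: real_matrix_def o_def scalar_mult_eq_scaleR linear_matrix_vector_mul_eq)

text \<open>An eigenvector X + \<i> Y of a real matrix B for the eigenvalue \<i> satisfies B X = - Y
  and B Y = X, so B squared negates X. If X vanished, so would Y.\<close>

lemma imaginary_unit_eigenvalue:
  fixes L :: "complex^'n \<Rightarrow> complex^'n"
  assumes "linear L" "eigenvalue_multiplicity L \<i> \<noteq> 0"
  obtains x where "x \<noteq> 0" "L (L x) = - x"
proof -
  let ?B = "real_matrix L"
  obtain W where W: "W \<noteq> 0" "map_matrix complex_of_real ?B *v W = \<i> *s W"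
    using eigenvector_if_multiplicity[OF assms(2)] .
  define X where "X = (\<chi> k. Re (W $ k))"
  define Y where "Y = (\<chi> k. Im (W $ k))"
  have WB: "(\<Sum>k\<in>UNIV. complex_of_real (?B $ j $ k) * W $ k) = \<i> * W $ j" for j
    using W(2) by (simp add: vec_eq_iff matrix_vector_mult_def map_matrix_def)
  have BX: "?B *v X = - Y" 
    using arg_cong[OF WB, of Re] by (simp add: vec_eq_iff matrix_vector_mult_def X_def Y_def)
  have BY: "?B *v Y = X" 
    using arg_cong[OF WB, of Im] by (simp add: vec_eq_iff matrix_vector_mult_def X_def Y_def)
  have X: "X \<noteq> 0"
  proof
    assume "X = 0"
    with BX have "Y = 0" by simp
    with \<open>X = 0\<close> have "W = 0" by (simp add: X_def Y_def vec_eq_iff complex_eq_iff)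
    with W show False by simp
  qed
  define x where "x = of_real_coords X"
  have "real_coords (L x) = - Y" using BX by (simp add: real_matrix_works[OF assms(1)] x_def)
  then have "of_real_coords (- Y) = L x" by (metis of_real_coords_real_coords)
  then have "real_coords (L (L x)) = ?B *v (- Y)"
    by (simp add: real_matrix_works[OF assms(1)])
  then have "real_coords (L (L x)) = - (?B *v Y)"
    by (simp add: vec.neg)
  then have "real_coords (L (L x)) = real_coords (- x)"
    by (simp add: BY x_def linear_neg[OF linear_real_coords])
  then have "L (L x) = - x" by (metis of_real_coords_real_coords)
  moreover have "x \<noteq> 0" using X
    by (metis x_def real_coords_of_real_coords linear_0[OF linear_real_coords])
  ultimately show thesis using that by blast
qed

lemma sum_UNIV_sum: "(\<Sum>k\<in>(UNIV::('a::finite + 'b::finite) set). f k) = (\<Sum>i\<in>UNIV. f (Inl i)) + (\<Sum>i\<in>UNIV. f (Inr i))"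
  unfolding UNIV_Plus_UNIV[symmetric] by (subst sum.Plus) (auto simp: sum.reindex)

lemma prod_UNIV_sum: "(\<Prod>k\<in>(UNIV::('a::finite + 'b::finite) set). f k) = (\<Prod>i\<in>UNIV. f (Inl i)) * (\<Prod>i\<in>UNIV. f (Inr i))"
  unfolding UNIV_Plus_UNIV[symmetric] by (subst prod.Plus) (auto simp: prod.reindex)

text \<open>Over the complex numbers the real form of multiplication by \<open>a\<close> is similar
  to a diagonal matrix in which \<open>a\<close> and its conjugate each appear CARD('n)
  times.\<close>

lemma charpoly_complex_scalar:
  fixes a :: complex
  defines "L \<equiv> (\<lambda>z::complex^'n. a *s z)"
  shows "charpoly (map_matrix complex_of_real (real_matrix L)) =
    [:-a, 1:] ^ CARD('n) * [:- cnj a, 1:] ^ CARD('n)"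
proof -
  let ?B = "map_matrix complex_of_real (real_matrix L)"
  \<comment> \<open>The 2 by 2 matrix with rows (p, q) and (r, s), tensored with the identity;
    products then reduce to the 2 by 2 case. The entries are constant polynomials so that the
    variable can be added.\<close>
  define c :: "complex \<Rightarrow> complex \<Rightarrow> complex \<Rightarrow> complex \<Rightarrow> complex poly^('n+'n)^('n+'n)" where
    "c p q r s = (\<chi> j k. case (j, k) of
       (Inl j, Inl k) \<Rightarrow> if j = k then [:p:] else 0 | (Inl j, Inr k) \<Rightarrow> if j = k then [:q:] else 0
     | (Inr j, Inl k) \<Rightarrow> if j = k then [:r:] else 0 | (Inr j, Inr k) \<Rightarrow> if j = k then [:s:] else 0)"
    for p q r s
  have c_mult: "c p q r s ** c p' q' r' s' =
      c (p * p' + q * r') (p * q' + q * s') (r * p' + s * r') (r * q' + s * s')" for p q r s p' q' r' s'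
    by (auto simp: c_def vec_eq_iff matrix_matrix_mult_def sum_UNIV_sum if_distrib[of "\<lambda>a. a * _"]
        if_distrib[of "\<lambda>a. _ * a"] sum.delta sum.delta' split: sum.split cong: if_cong)
  have c_1: "c 1 0 0 1 = mat 1"
    by (auto simp: c_def mat_def vec_eq_iff one_pCons split: sum.split)
  have matX: "mat [:0, 1:] ** M = M ** mat [:0, 1:]" for M :: "complex poly^('n+'n)^('n+'n)"
    by (auto simp: vec_eq_iff matrix_matrix_mult_def mat_def if_distrib[of "\<lambda>a. a * _"]
        if_distrib[of "\<lambda>a. _ * a"] sum.delta sum.delta' mult.commute cong: if_cong)
  have "linear L"
    unfolding L_def by (rule linearI) (auto simp: vec_eq_iff algebra_simps)
  have "real_matrix L $ j $ k = real_coords (L (of_real_coords (axis k 1))) $ j" for j k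
    by (simp add: real_matrix_def matrix_def)
  then have B: "map_matrix (\<lambda>a. [:a:]) ?B = c (Re a) (- Im a) (Im a) (Re a)"
    by (auto simp: vec_eq_iff map_matrix_def c_def L_def real_coords_def of_real_coords_def axis_def
        split: sum.split)
  \<comment> \<open>the rows of \<open>?P\<close> are left eigenvectors of the block [[Re a, - Im a], [Im a, Re a]]\<close>
  let ?P = "c 1 \<i> 1 (-\<i>)" and ?Q = "c (1/2) (1/2) (-\<i>/2) (\<i>/2)"
  let ?D = "c a 0 0 (cnj a)"
  have "?P ** (mat [:0, 1:] - map_matrix (\<lambda>a. [:a:]) ?B) = (mat [:0, 1:] - ?D) ** ?P"
  proof -
    have "?P ** c (Re a) (- Im a) (Im a) (Re a) = ?D ** ?P"
      unfolding c_mult by (rule arg_cong4[where f = c]) (auto simp: complex_eq_iff)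
    moreover have "A ** (B - C) = A ** B - A ** C" "(B - C) ** A = B ** A - C ** A"
      for A B C :: "complex poly^('n+'n)^('n+'n)"
      by (simp_all add: vec_eq_iff matrix_matrix_mult_def algebra_simps sum_subtractf)
    ultimately show ?thesis unfolding B
      by (simp add: matX)
  qed
  then have eq: "det ?P * charpoly ?B = det (mat [:0, 1:] - ?D) * det ?P"
    unfolding charpoly_def det_mul[symmetric] by simp
  have "?P ** ?Q = mat 1" unfolding c_mult c_1[symmetric] by (rule arg_cong4[where f = c]) auto
  then have "det ?P * det ?Q = 1" by (metis det_mul det_I)
  then have "det ?P \<noteq> 0" by auto
  with eq have "charpoly ?B = det (mat [:0, 1:] - ?D)" by simp
  also have "\<dots> = (\<Prod>k\<in>UNIV. (mat [:0, 1:] - ?D) $ k $ k)"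
    by (rule det_diagonal) (auto simp: c_def mat_def split: sum.split)
  also have "\<dots> = [:-a, 1:] ^ CARD('n) * [:- cnj a, 1:] ^ CARD('n)"
    by (simp add: prod_UNIV_sum c_def mat_def)
  finally show ?thesis .
qed

text \<open>A non-real \<open>a\<close> differs from its conjugate, so neither factor of the
  characteristic polynomial contributes to the order of the other root.\<close>

lemma eigenvalue_multiplicity_complex_scalar:
  assumes "Im a \<noteq> 0"
  shows "eigenvalue_multiplicity (\<lambda>z::complex^'n. a *s z) a = CARD('n)"
    and "eigenvalue_multiplicity (\<lambda>z::complex^'n. a *s z) (cnj a) = CARD('n)"
proof -
  have ne: "a \<noteq> cnj a" using assms by (auto simp: complex_eq_iff)
  have "Polynomial.order b ([:-b, 1:] ^ n * [:-c, 1:] ^ m) = n" if "b \<noteq> c" for b c :: complex and n m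
  proof -
    have "Polynomial.order b ([:-b, 1:] ^ n * [:-c, 1:] ^ m) = Polynomial.order b ([:-b, 1:] ^ n) + Polynomial.order b ([:-c, 1:] ^ m)"
      by (rule order_mult) auto
    also have "Polynomial.order b ([:-c, 1:] ^ m) = 0"
      using that by (intro order_0I) (simp add: poly_power)
    finally show ?thesis by (simp add: order_power_n_n)
  qed
  from this[OF ne] this[OF ne[symmetric]] show
    "eigenvalue_multiplicity (\<lambda>z::complex^'n. a *s z) a = CARD('n)"
    "eigenvalue_multiplicity (\<lambda>z::complex^'n. a *s z) (cnj a) = CARD('n)"
    unfolding eigenvalue_multiplicity_def charpoly_complex_scalar by (auto simp: mult.commute)
qed

section \<open>Circular solutions of a unitarily equivariant family\<close>

lemma Ck_map_Suc_imp: "Ck_map (Suc k) f \<Longrightarrow> Ck_map k f"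
proof (induction k arbitrary: f)
  case 0
  then show ?case
    by (auto simp: continuous_on_eq_continuous_at intro: differentiable_imp_continuous_within)
next
  case (Suc k)
  then show ?case by (metis Ck_map.simps(2))
qed

text \<open>Uniqueness of derivatives allows any known derivative in place of the chosen
  \<open>frechet_derivative\<close>.\<close>

lemma Ck_map_SucI:
  assumes "\<And>x. (f has_derivative f' x) (at x)" "\<And>v. Ck_map k (\<lambda>x. f' x v)"
  shows "Ck_map (Suc k) f"
proof -
  have "frechet_derivative f (at x) = f' x" for x
    using assms(1) frechet_derivative_at by metis
  then show ?thesis using assms by (auto simp: differentiable_def)
qed

lemma Ck_map_const: "Ck_map k (\<lambda>x. c)"
proof (induction k arbitrary: c)
  case (Suc k)
  show ?case by (rule Ck_map_SucI[where f' = "\<lambda>x v. 0"]) (auto intro: Suc derivative_intros)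
qed auto

lemma Ck_map_bounded_linear:
  assumes "bounded_linear f"
  shows "Ck_map k f"
proof (cases k)
  case 0
  then show ?thesis using assms by (simp add: linear_continuous_on)
next
  case (Suc n)
  have "Ck_map (Suc n) f"
    by (rule Ck_map_SucI[where f' = "\<lambda>x. f"])
      (auto intro: Ck_map_const bounded_linear_imp_has_derivative assms)
  then show ?thesis by (simp only: Suc)
qed

lemma Ck_map_add:
  assumes "Ck_map k f" "Ck_map k g"
  shows "Ck_map k (\<lambda>x. f x + g x)"
  using assms
proof (induction k arbitrary: f g)
  case 0
  then show ?case by (auto intro: continuous_intros)
next
  case (Suc k)
  show ?case
  proof (rule Ck_map_SucI)
    show "((\<lambda>x. f x + g x) has_derivative
      (\<lambda>v. frechet_derivative f (at x) v + frechet_derivative g (at x) v)) (at x)" for x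
      using Suc.prems by (intro has_derivative_add) (auto simp: frechet_derivative_works[symmetric])
  qed (use Suc in auto)
qed

text \<open>By the Leibniz rule both terms of the derivative are again bilinear expressions, with
  factors of class \<open>k\<close>, so the induction closes.\<close>

lemma Ck_map_bilinear:
  assumes B: "bounded_bilinear B" and "Ck_map k f" "Ck_map k g"
  shows "Ck_map k (\<lambda>x. B (f x) (g x))"
  using assms(2,3)
proof (induction k arbitrary: f g)
  case 0
  then show ?case by (auto intro: bounded_bilinear.continuous_on[OF B])
next
  case (Suc k)
  show ?case
  proof (rule Ck_map_SucI)
    show "((\<lambda>x. B (f x) (g x)) has_derivative
      (\<lambda>v. B (f x) (frechet_derivative g (at x) v) + B (frechet_derivative f (at x) v) (g x))) (at x)" for x
      using Suc.prems
      by (intro bounded_bilinear.FDERIV[OF B]) (auto simp: frechet_derivative_works[symmetric])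
    show "Ck_map k (\<lambda>x. B (f x) (frechet_derivative g (at x) v) + B (frechet_derivative f (at x) v) (g x))" for v
      using Suc.prems by (intro Ck_map_add Suc.IH) (auto intro: Ck_map_Suc_imp)
  qed
qed

section \<open>The Hopf normal form and its circular orbits\<close>

definition hopf_normal_form :: "(complex^3) \<times> real \<Rightarrow> complex^3" where
  "hopf_normal_form = (\<lambda>(z, lam). lam *\<^sub>R z + \<i> *s z - (z \<bullet> z) *\<^sub>R z)"

lemma vector_smult_eq_scaleR: "complex_of_real r *s z = r *\<^sub>R z"
  by (auto simp: vec_eq_iff complex_eq_iff)

lemma norm_vector_smult: "norm (c *s z) = norm c * norm (z::complex^'n)"
  by (simp add: norm_vec_def norm_mult L2_set_right_distrib)

lemma bounded_linear_vector_smult: "bounded_linear (\<lambda>z::complex^'n. c *s z)"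
  by (rule bounded_linear_intro[where K = "norm c"])
    (auto simp: norm_vector_smult vec_eq_iff algebra_simps)

lemma smooth_hopf_normal_form: "smooth_map hopf_normal_form"
proof -
  have fst: "Ck_map k (fst :: (complex^3) \<times> real \<Rightarrow> _)" and snd: "Ck_map k (snd :: (complex^3) \<times> real \<Rightarrow> _)" for k
    by (intro Ck_map_bounded_linear bounded_linear_fst bounded_linear_snd)+
  have "Ck_map k (\<lambda>p::(complex^3) \<times> real. snd p *\<^sub>R fst p + (\<i> *s fst p + (-1) *\<^sub>R ((fst p \<bullet> fst p) *\<^sub>R fst p)))" for k
    by (intro Ck_map_add Ck_map_bilinear[OF bounded_bilinear_scaleR]
        Ck_map_bilinear[OF bounded_bilinear_inner] fst snd Ck_map_const
        Ck_map_bounded_linear bounded_linear_compose[OF bounded_linear_vector_smult bounded_linear_fst])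
  then show ?thesis
    by (simp add: smooth_map_def hopf_normal_form_def case_prod_unfold algebra_simps)
qed

lemma hopf_normal_form_derivative:
  "frechet_derivative (\<lambda>z. hopf_normal_form (z, lam)) (at 0) = (\<lambda>z. Complex lam 1 *s z)"
proof (rule frechet_derivative_at[symmetric])
  have "((\<lambda>z::complex^3. lam *\<^sub>R z + \<i> *s z - (z \<bullet> z) *\<^sub>R z) has_derivative
      (\<lambda>v. lam *\<^sub>R v + \<i> *s v - (((0::complex^3) \<bullet> 0) *\<^sub>R v + (0 \<bullet> v + v \<bullet> 0) *\<^sub>R 0))) (at 0)"
    by (intro has_derivative_add has_derivative_diff bounded_linear_imp_has_derivative
        bounded_linear_vector_smult bounded_linear_scaleR_right
        has_derivative_scaleR has_derivative_inner has_derivative_ident)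
  moreover have "(\<lambda>v::complex^3. lam *\<^sub>R v + \<i> *s v - (((0::complex^3) \<bullet> 0) *\<^sub>R v + (0 \<bullet> v + v \<bullet> 0) *\<^sub>R 0)) =
    (\<lambda>z. Complex lam 1 *s z)"
    by (auto simp: fun_eq_iff vec_eq_iff complex_eq_iff)
  ultimately show "((\<lambda>z. hopf_normal_form (z, lam)) has_derivative (\<lambda>z. Complex lam 1 *s z)) (at 0)"
    by (simp add: hopf_normal_form_def)
qed

lemma matrix_vector_smult: "A *v (c *s z) = c *s (A *v z)" for z :: "complex^'n"
  by (simp add: vec_eq_iff matrix_vector_mult_def sum_distrib_left algebra_simps)

text \<open>Group elements are complex matrices, so they commute with \<open>\<i>\<close>, and
  isometries, so they keep \<open>z \<bullet> z\<close>. At the origin the cubic term drops out and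
  multiplication by \<open>Complex lam 1\<close> remains.\<close>

lemma hopf_family_normal_form:
  assumes "\<And>g z. g \<in> carrier G \<Longrightarrow> norm (g *v z) = norm z"
  shows "hopf_family G (*v) hopf_normal_form"
  unfolding hopf_family_def
proof (intro conjI allI ballI)
  fix g :: "complex^3^3" and x :: "complex^3" and lam :: real
  assume g: "g \<in> carrier G"
  have "(g *v x) \<bullet> (g *v x) = x \<bullet> x"
    using assms[OF g] by (simp add: dot_square_norm)
  moreover have "g *v (r *\<^sub>R z) = r *\<^sub>R (g *v z)" for r z
    unfolding vector_smult_eq_scaleR[symmetric] by (rule matrix_vector_smult)
  ultimately show "hopf_normal_form (g *v x, lam) = g *v hopf_normal_form (x, lam)"
    by (simp add: hopf_normal_form_def matrix_vector_smult matrix_vector_mult_diff_distrib matrix_vector_right_distrib)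
next
  have "eigenvalue_multiplicity (\<lambda>z::complex^3. Complex lam 1 *s z) (Complex lam 1) = CARD(3)"
    "eigenvalue_multiplicity (\<lambda>z::complex^3. Complex lam 1 *s z) (cnj (Complex lam 1)) = CARD(3)"
    for lam by (intro eigenvalue_multiplicity_complex_scalar; simp)+
  moreover have "cnj (Complex lam 1) = Complex lam (-1)" for lam by (simp add: complex_eq_iff)
  ultimately show "\<exists>\<sigma> \<rho>. (\<forall>lam. let L = frechet_derivative (\<lambda>x. hopf_normal_form (x, lam)) (at 0) in
      eigenvalue_multiplicity L (Complex (\<sigma> lam) (\<rho> lam)) = 3 \<and>
      eigenvalue_multiplicity L (Complex (\<sigma> lam) (- \<rho> lam)) = 3) \<and>
      \<sigma> 0 = 0 \<and> \<rho> 0 = 1 \<and> (\<exists>d. (\<sigma> has_real_derivative d) (at 0) \<and> d \<noteq> 0)"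
    by (intro exI[of _ "\<lambda>lam. lam"] exI[of _ "\<lambda>lam. 1"] conjI)
      (auto simp: hopf_normal_form_derivative intro!: exI[of _ 1])
qed (rule smooth_hopf_normal_form, simp add: hopf_normal_form_def)

text \<open>The normal form commutes with all unitary maps, so that every complex direction carries
  a circular periodic solution.\<close>

lemma occurs_circular:
  assumes norm: "\<And>g z. g \<in> carrier G \<Longrightarrow> norm (g *v z) = norm z" and v: "v \<noteq> 0"
  shows "occurs_at_primary_hopf G (*v) {g\<in>carrier G. \<exists>c. g *v v = c *s v} {g\<in>carrier G. g *v v = v}"
proof -
  define n where "n = norm v"
  have n: "n > 0" "v \<bullet> v = n^2" using v by (auto simp: n_def dot_square_norm)
  define x where "x s t = (of_real s * cis t) *s v" for s t
  have nx: "norm (x s t) = s * n" if "s > 0" for s t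
    using that by (simp add: x_def norm_vector_smult norm_mult n_def)
  \<comment> \<open>The parameter is the squared radius: the two radial terms cancel and only
    \<open>\<i> *s z\<close> is left.\<close>
  have sol: "(x s has_vector_derivative hopf_normal_form (x s t, s^2 * n^2)) (at t)" if "s > 0" for s t
  proof -
    have "(cis has_vector_derivative \<i> * cis t) (at t)"
      using has_derivative_cis[of "\<lambda>x. x" "\<lambda>x. x" t UNIV]
      by (simp add: has_vector_derivative_def mult.commute scaleR_conv_of_real)
    then have "((\<lambda>t. of_real s * cis t) has_vector_derivative of_real s * (\<i> * cis t)) (at t)"
      by (rule has_vector_derivative_mult_right)
    moreover have "bounded_linear (\<lambda>c. c *s v)"
      by (rule bounded_linear_intro[where K = "norm v"])
        (auto simp: norm_vector_smult vec_eq_iff algebra_simps)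
    ultimately have "(x s has_vector_derivative (of_real s * (\<i> * cis t)) *s v) (at t)"
      unfolding x_def by (rule bounded_linear.has_vector_derivative[rotated])
    moreover have "x s t \<bullet> x s t = s^2 * n^2"
      using nx[OF that, of t] by (simp add: dot_square_norm power_mult_distrib)
    ultimately show ?thesis
      by (simp add: hopf_normal_form_def x_def mult.left_commute)
  qed
  have per: "periodic_solution (\<lambda>y. hopf_normal_form (y, s^2 * n^2)) (x s) (2 * pi)" if "s > 0" for s
    unfolding periodic_solution_def
  proof (intro conjI allI impI)
    fix Q :: real assume Q: "0 < Q \<and> Q < 2 * pi"
    have "x s Q \<noteq> x s 0"
    proof
      assume "x s Q = x s 0"
      then have "(of_real s * cis Q - of_real s) *s v = 0" by (simp add: x_def vector_sub_rdistrib)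
      then have "cis Q = 1" using v that by (auto simp: vec_eq_iff)
      then have "cos Q = 1" by (simp add: complex_eq_iff)
      then obtain n :: int where n: "Q = of_int n * (2 * pi)"
        unfolding cos_one_2pi_int by (auto simp: mult.assoc)
      then have "0 < real_of_int n" "real_of_int n < 1" using Q by (auto simp: zero_less_mult_iff)
      then show False by simp
    qed
    then show "\<exists>t. x s (t + Q) \<noteq> x s t" by (intro exI[of _ 0]) simp
  qed (use sol that in \<open>auto simp: x_def cis.ctr\<close>)
  have branch: "hopf_branch hopf_normal_form (\<lambda>s. s^2 * n^2) x (\<lambda>s. 2 * pi)"
    unfolding hopf_branch_def
  proof (intro conjI)
    show "continuous_on ({0<..1} \<times> UNIV) (\<lambda>(s, t). x s t)"
      unfolding x_def case_prod_beta vector_scalar_mult_def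
      by (intro continuous_intros)
    show "((\<lambda>s. s^2 * n^2) \<longlongrightarrow> 0) (at_right 0)" by (auto intro!: tendsto_eq_intros)
    have "((\<lambda>s. s * n) \<longlongrightarrow> 0) (at_right 0)" by (auto intro!: tendsto_eq_intros)
    moreover have "eventually (\<lambda>s. s * n = (SUP t. norm (x s t))) (at_right 0)"
      by (auto simp: eventually_at_right_less nx intro!: eventually_mono[OF eventually_at_right_less])
    ultimately show "((\<lambda>s. SUP t. norm (x s t)) \<longlongrightarrow> 0) (at_right 0)"
      by (rule Lim_transform_eventually)
  qed (use per n in \<open>auto intro!: continuous_intros\<close>)
  \<comment> \<open>The orbit is a full circle in the complex line of \<open>v\<close>; hence an
    isometry preserves it as a set exactly if it multiplies \<open>v\<close> by a scalar.\<close>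
  have range_x: "range (x s) = {c *s v |c. norm c = s}" if "s > 0" for s
  proof safe
    fix c :: complex assume s: "s = norm c"
    have "c *s v = x s (Arg c)"
      using s that rcis_cmod_Arg[of c] by (simp add: x_def rcis_def)
    then show "c *s v \<in> range (x (norm c))" using s by blast
  qed (use that in \<open>auto simp: x_def norm_mult\<close>)
  have spatial: "spatial_symmetries G (*v) (x s) = {g\<in>carrier G. g *v v = v}" if "s > 0" for s
  proof -
    have "(\<forall>t. g *v x s t = x s t) \<longleftrightarrow> g *v v = v" for g
    proof
      assume "\<forall>t. g *v x s t = x s t"
      then have "of_real s *s (g *v v) = of_real s *s v"
        by (metis x_def cis_zero mult.right_neutral matrix_vector_smult)
      then show "g *v v = v" using that by (simp add: vec_eq_iff)
    qed (auto simp: x_def matrix_vector_smult)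
    then show ?thesis by (auto simp: spatial_symmetries_def)
  qed
  have spt: "spatiotemporal_symmetries G (*v) (x s) = {g\<in>carrier G. \<exists>c. g *v v = c *s v}" if s: "s > 0" for s
  proof -
    have *: "(*v) g ` range (x s) = range (x s) \<longleftrightarrow> (\<exists>c. g *v v = c *s v)" if g: "g \<in> carrier G" for g
    proof
      assume *: "(*v) g ` range (x s) = range (x s)"
      have "of_real s *s v \<in> range (x s)" using s by (auto simp: range_x)
      then have "g *v (of_real s *s v) \<in> range (x s)" using * by blast
      then obtain c where "of_real s *s (g *v v) = c *s v"
        using s by (auto simp: range_x matrix_vector_smult)
      then have "g *v v = (c / of_real s) *s v" using s by (auto simp: vec_eq_iff field_simps)
      then show "\<exists>c. g *v v = c *s v" ..
    next
      assume "\<exists>c. g *v v = c *s v"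
      then obtain c where c: "g *v v = c *s v" by blast
      have "norm c * norm v = norm v" using norm[OF g, of v] by (simp add: c norm_vector_smult)
      then have nc: "norm c = 1" using v by simp
      then have "c \<noteq> 0" by auto
      show "(*v) g ` range (x s) = range (x s)"
        unfolding range_x[OF s]
      proof safe
        fix b :: complex assume "s = norm b"
        have "b *s v = g *v ((b / c) *s v)" using \<open>c \<noteq> 0\<close> by (simp add: matrix_vector_smult c)
        moreover have "norm (b / c) = norm b" using nc by (simp add: norm_divide)
        ultimately show "b *s v \<in> (*v) g ` {d *s v |d. norm d = norm b}" by blast
      qed (auto simp: matrix_vector_smult c norm_mult nc)
    qed
    then show ?thesis unfolding spatiotemporal_symmetries_def by (intro Collect_cong conj_cong refl)
  qed
  show ?thesis
    unfolding occurs_at_primary_hopf_def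
  proof (intro exI conjI ballI)
    show "hopf_family G (*v) hopf_normal_form" by (rule hopf_family_normal_form[OF norm])
    show "hopf_branch hopf_normal_form (\<lambda>s. s^2 * n^2) x (\<lambda>s. 2 * pi)" by (rule branch)
  qed (simp_all add: spatial spt)
qed

section \<open>Periodic solutions in an invariant plane\<close>

text \<open>A single linear map, the derivative at parameter 0, serves all small parameters: the
  mean value inequality is applied to the field minus \<open>A\<close>, whose derivative is small
  near the origin.\<close>

lemma smooth_linear_approximation:
  fixes f :: "'a::euclidean_space \<times> real \<Rightarrow> 'b::euclidean_space"
  assumes f: "smooth_map f" and e: "e > 0"
  defines "A \<equiv> frechet_derivative (\<lambda>y. f (y, 0)) (at 0)"
  obtains \<delta> where "\<delta> > 0"
    "\<forall>lam a b. \<bar>lam\<bar> < \<delta> \<and> norm a < \<delta> \<and> norm b < \<delta> \<longrightarrow>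
       norm (f (a, lam) - f (b, lam) - A (a - b)) \<le> e * norm (a - b)"
    "((\<lambda>y. f (y, 0)) has_derivative A) (at 0)"
proof -
  define D where "D p = frechet_derivative f (at p)" for p
  have C1: "Ck_map (Suc 0) f" using f by (simp only: smooth_map_def)
  have D: "(f has_derivative D p) (at p)" for p
    using Ck_map.simps(2)[THEN iffD1, OF C1] by (simp only: D_def frechet_derivative_works[symmetric])
  have contD: "isCont (\<lambda>p. D p v) p" for v p
    using Ck_map.simps(2)[THEN iffD1, OF C1]
    by (simp only: D_def Ck_map.simps(1) continuous_on_eq_continuous_at[OF open_UNIV] UNIV_I ball_UNIV)
  have partial: "((\<lambda>y. f (y, lam)) has_derivative (\<lambda>v. D (y, lam) (v, 0))) (at y)" for y lam
  proof -
    have "((\<lambda>y. (y, lam)) has_derivative (\<lambda>v. (v, 0))) (at y)"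
      by (intro has_derivative_Pair has_derivative_ident has_derivative_const)
    from diff_chain_at[OF this D] show ?thesis by (simp add: o_def)
  qed
  have A: "A = (\<lambda>v. D (0, 0) (v, 0))"
    unfolding A_def by (rule frechet_derivative_at[symmetric]) (rule partial)
  have linA: "bounded_linear A" using partial[of 0 0] unfolding A by (rule has_derivative_bounded_linear)
  \<comment> \<open>Continuity of the derivative is known direction by direction; the bounds on the
    basis vectors add up to an operator bound with factor DIM('a).\<close>
  define \<epsilon> where "\<epsilon> = e / DIM('a)"
  have "\<epsilon> > 0" using e by (simp add: \<epsilon>_def)
  have "\<forall>b\<in>(Basis::'a set). eventually (\<lambda>p. dist (D p (b, 0)) (D (0,0) (b, 0)) < \<epsilon>) (nhds (0, 0))"
  proof (intro ballI tendstoD[OF _ \<open>\<epsilon> > 0\<close>])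
    fix b :: 'a
    show "((\<lambda>p. D p (b, 0)) \<longlongrightarrow> D (0, 0) (b, 0)) (nhds (0, 0))"
      using contD[of "(0, 0)" "(b, 0)"] tendsto_at_iff_tendsto_nhds[of "\<lambda>p. D p (b, 0)" "(0, 0)"]
      by (simp add: isCont_def)
  qed
  then have "eventually (\<lambda>p. \<forall>b\<in>(Basis::'a set). dist (D p (b, 0)) (D (0,0) (b, 0)) < \<epsilon>) (nhds (0, 0))"
    by (simp add: eventually_ball_finite_distrib)
  then obtain d where d: "d > 0" and close: "\<And>p b. dist p (0, 0) < d \<Longrightarrow> b \<in> (Basis::'a set) \<Longrightarrow>
      dist (D p (b, 0)) (D (0,0) (b, 0)) < \<epsilon>"
    unfolding eventually_nhds_metric by blast
  have bound: "norm (D (y, lam) (v, 0) - A v) \<le> e * norm v"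
    if "norm y < d/2" "\<bar>lam\<bar> < d/2" for y lam v
  proof -
    define T where "T v = D (y, lam) (v, 0) - A v" for v
    have linT: "linear T"
      unfolding T_def using partial[THEN has_derivative_linear] linA[THEN bounded_linear.linear]
      by (rule linear_compose_sub)
    have "dist (y, lam) (0, 0) \<le> norm y + \<bar>lam\<bar>"
      using norm_Pair_le[of y lam] by (simp add: dist_norm)
    then have dist: "dist (y, lam) (0, 0) < d" using that by linarith
    have "T v = (\<Sum>b\<in>Basis. (v \<bullet> b) *\<^sub>R T b)"
      using linear_sum[OF linT, of "\<lambda>b. (v \<bullet> b) *\<^sub>R b" Basis]
      by (simp add: linear_scale[OF linT] euclidean_representation)
    also have "norm \<dots> \<le> (\<Sum>b\<in>(Basis::'a set). norm v * \<epsilon>)"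
    proof (rule sum_norm_le)
      fix b :: 'a assume b: "b \<in> Basis"
      have "norm (T b) \<le> \<epsilon>" using close[OF dist b] by (simp add: T_def A dist_norm)
      then show "norm ((v \<bullet> b) *\<^sub>R T b) \<le> norm v * \<epsilon>"
        using Basis_le_norm[OF b, of v] by (auto intro!: mult_mono)
    qed
    also have "\<dots> = e * norm v" by (simp add: \<epsilon>_def)
    finally show ?thesis by (simp add: T_def)
  qed
  show thesis
  proof (rule that[of "d/2"], safe)
    fix lam :: real and a b :: 'a
    assume lam: "\<bar>lam\<bar> < d/2" and ab: "norm a < d/2" "norm b < d/2"
    have "norm ((f (a, lam) - A a) - (f (b, lam) - A b)) \<le> e * norm (a - b)"
    proof (rule differentiable_bound[where S = "ball 0 (d/2)"])
      fix y :: 'a assume y: "y \<in> ball 0 (d/2)"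
      show "((\<lambda>y. f (y, lam) - A y) has_derivative (\<lambda>v. D (y, lam) (v, 0) - A v)) (at y within ball 0 (d/2))"
        by (intro has_derivative_diff has_derivative_at_withinI[OF partial] bounded_linear_imp_has_derivative linA)
      show "onorm (\<lambda>v. D (y, lam) (v, 0) - A v) \<le> e"
        using bound[OF _ lam] y by (intro onorm_le) auto
    qed (use ab in auto)
    moreover have "(f (a, lam) - A a) - (f (b, lam) - A b) = f (a, lam) - f (b, lam) - A (a - b)"
      using linA by (simp add: linear_diff bounded_linear.linear)
    ultimately show "norm (f (a, lam) - f (b, lam) - A (a - b)) \<le> e * norm (a - b)"
      by simp
  qed (use d partial[of 0 0] in \<open>auto simp: A\<close>)
qed

section \<open>Structure of the linearisation and uniqueness of orbits\<close>

text \<open>Schur's lemma by hand. If \<open>y\<close> vanishes at \<open>i\<close>, the element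
  from \<open>refl\<close> negates \<open>y\<close> but keeps the \<open>i\<close>-th coordinate of
  \<open>L y\<close>, which must therefore be 0; so \<open>L\<close> is diagonal. The elements from
  \<open>perm\<close> make its diagonal entries equal.\<close>

lemma commuting_map_componentwise:
  fixes L :: "complex^3 \<Rightarrow> complex^3"
  assumes L: "linear L" and comm: "\<And>g y. g \<in> S \<Longrightarrow> L (g *v y) = g *v L y"
    and refl: "\<And>i. \<exists>g\<in>S. \<forall>z j. (g *v z) $ j = (if j = i then z $ j else - (z $ j))"
    and perm: "\<And>i j. \<exists>g\<in>S. \<forall>z. (g *v z) $ i = z $ j"
  obtains m where "linear m" "\<And>y i. L y $ i = m (y $ i)"
proof -
  have off: "L y $ i = 0" if "y $ i = 0" for y i
  proof -
    obtain g where g: "g \<in> S" "\<And>z j. (g *v z) $ j = (if j = i then z $ j else - (z $ j))"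
      using refl by blast
    have "g *v y = - y" using that by (auto simp: vec_eq_iff g)
    then have "- L y = g *v L y" using comm[OF g(1), of y] by (simp add: linear_neg[OF L])
    then have "- (L y $ i) = L y $ i" by (metis g(2) vector_uminus_component)
    then show ?thesis by simp
  qed
  define m where "m i c = L (axis i c) $ i" for i c
  have Lm: "L y $ i = m i (y $ i)" for y i
  proof -
    have "L (y - axis i (y $ i)) $ i = 0" by (rule off) simp
    then show ?thesis by (simp add: linear_diff[OF L] m_def)
  qed
  have same: "m j c = m i c" for i j c
  proof -
    obtain g where g: "g \<in> S" "\<And>z. (g *v z) $ i = z $ j" using perm by blast
    define y where "y = axis j c"
    have "L y $ j = L (g *v y) $ i" by (simp add: comm g)
    then show ?thesis by (simp add: Lm g) (simp add: y_def)
  qed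
  have "axis i (a + b) = axis i a + axis i b" "axis i (r *\<^sub>R a) = r *\<^sub>R axis i a"
    for i :: 3 and a b :: complex and r
    by (auto simp: vec_eq_iff axis_def)
  then have "linear (m 1)"
    unfolding m_def by (intro linearI) (auto simp: linear_add[OF L] linear_scale[OF L])
  with Lm same show thesis by (metis that)
qed

text \<open>The eigenvalue condition yields only one vector. It suffices because \<open>c\<close>
  and \<open>m c\<close> span the plane: a relation \<open>m c = k *\<^sub>R c\<close> would give
  \<open>k * k = -1\<close>.\<close>

lemma square_minus_one_if_vector:
  fixes m :: "complex \<Rightarrow> complex"
  assumes m: "linear m" and c: "c \<noteq> 0" "m (m c) = - c"
  shows "m (m b) = - b"
proof -
  have ndep: "m c \<noteq> k *\<^sub>R c" for k
  proof
    assume k: "m c = k *\<^sub>R c"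
    then have "(k * k) *\<^sub>R c = (-1) *\<^sub>R c" using c(2) by (simp add: linear_scale[OF m])
    then have "k * k = -1" using c(1) by (metis scaleR_cancel_right)
    then show False using zero_le_square[of k] by linarith
  qed
  have "m c \<notin> span {c}" using ndep by (auto simp: span_singleton)
  moreover have "m c \<noteq> c" using ndep[of 1] by simp
  ultimately have "independent {m c, c}"
    using c(1) by (simp add: independent_insert)
  then have "dim {m c, c} = 2"
    using dim_eq_card_independent[of "{m c, c}"] \<open>m c \<noteq> c\<close> by simp
  then have "span {m c, c} = UNIV"
    by (intro dim_eq_full[THEN iffD1]) simp
  then have "b \<in> span {m c, c}" by simp
  then obtain s where "b - s *\<^sub>R m c \<in> span {c}" unfolding span_insert by blast
  then obtain r where "b - s *\<^sub>R m c = r *\<^sub>R c" by (auto simp: span_singleton)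
  then have b: "b = r *\<^sub>R c + s *\<^sub>R m c" by (simp add: algebra_simps)
  have "m (m (m c)) = - m c" by (simp add: c linear_neg[OF m])
  then show ?thesis by (simp add: b linear_add[OF m] linear_diff[OF m] linear_scale[OF m] c)
qed
text \<open>The Lipschitz bound is asked only along the two trajectories, since the field will be
  controlled only near the origin. The difference of the shifted solutions starts at zero and obeys
  a linear growth bound.\<close>

lemma orbits_equal_if_meet:
  fixes y z :: "real \<Rightarrow> 'a::real_inner"
  assumes "\<And>t. (y has_vector_derivative F (y t)) (at t)" "\<And>t. (z has_vector_derivative F (z t)) (at t)"
    and "\<And>s t. norm (F (y s) - F (z t)) \<le> C * norm (y s - z t)"
    and "y s = z t"
  shows "y (s + r) = z (t + r)"
proof -
  have shift: "((\<lambda>r. a + r) has_vector_derivative 1) (at r)" for a r :: real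
    by (rule derivative_eq_intros refl | simp)+
  have "(y \<circ> (\<lambda>r. s + r) has_vector_derivative F (y (s + r))) (at r)"
    "(z \<circ> (\<lambda>r. t + r) has_vector_derivative F (z (t + r))) (at r)" for r
    using vector_diff_chain_at[OF shift assms(1)] vector_diff_chain_at[OF shift assms(2)] by simp_all
  from has_vector_derivative_diff[OF this]
  have "(y \<circ> (\<lambda>r. s + r)) r - (z \<circ> (\<lambda>r. t + r)) r = 0"
    by (rule linear_growth_zero[of "\<lambda>r. (y \<circ> (\<lambda>r. s + r)) r - (z \<circ> (\<lambda>r. t + r)) r"
          "\<lambda>r. F (y (s + r)) - F (z (t + r))" C 0]) (auto simp: assms)
  then show ?thesis by simp
qed

text \<open>\<open>m\<close> is a complex structure on the real plane, and Re c - \<i> Re (m c) is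
  the functional Re made complex linear for it. A nonzero kernel vector would make the imaginary
  axis an eigenline of \<open>m\<close> whose real eigenvalue has square -1.\<close>

lemma complexifying_functional:
  fixes m :: "complex \<Rightarrow> complex"
  assumes m: "linear m" and mm: "\<And>c. m (m c) = - c"
  obtains l :: "complex \<Rightarrow> complex" where "linear l" "inj l" "\<And>c. l (m c) = \<i> * l c"
proof -
  define l where "l c = Complex (Re c) (- Re (m c))" for c
  have l: "linear l"
    by (rule linearI) (auto simp: l_def linear_add[OF m] linear_scale[OF m] complex_eq_iff)
  have "c = 0" if "l c = 0" for c
  proof -
    have re: "Re c = 0" "Re (m c) = 0" using that by (auto simp: l_def complex_eq_iff)
    have "c = Im c *\<^sub>R \<i>" "m c = Im (m c) *\<^sub>R \<i>"
      using re by (auto simp: complex_eq_iff)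
    then have *: "Im c *\<^sub>R m \<i> = Im (m c) *\<^sub>R \<i>" by (metis linear_scale[OF m])
    show "c = 0"
    proof (rule ccontr)
      assume "c \<noteq> 0"
      then have "Im c \<noteq> 0" using re by (auto simp: complex_eq_iff)
      define k where "k = Im (m c) / Im c"
      have k: "m \<i> = k *\<^sub>R \<i>"
        using * \<open>Im c \<noteq> 0\<close> by (auto simp: k_def complex_eq_iff field_simps)
      have "(k * k) *\<^sub>R \<i> = - \<i>" using mm[of \<i>] k by (simp add: linear_scale[OF m])
      then have "k * k = -1" by (simp add: complex_eq_iff)
      then show False using zero_le_square[of k] by linarith
    qed
  qed
  then have "inj l" using l by (simp add: linear_injective_0)
  moreover have "l (m c) = \<i> * l c" for c by (simp add: l_def mm complex_eq_iff)
  ultimately show thesis using that l by blast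
qed

text \<open>A real supremum bounds its family only if the family is bounded above; this lets the
  amplitude in \<open>hopf_branch\<close> control every point of the orbit.\<close>

lemma bdd_above_norm_periodic_solution:
  assumes "periodic_solution F x P"
  shows "bdd_above (range (\<lambda>t. norm (x t)))"
proof -
  have P: "0 < P" "\<And>t. x (t + P) = x t" "\<And>t. (x has_vector_derivative F (x t)) (at t)"
    using assms by (auto simp: periodic_solution_def)
  have "continuous_on UNIV x"
    using P(3) by (meson continuous_at_imp_continuous_on has_vector_derivative_continuous)
  then have "compact (x ` {0..P})"
    by (meson compact_Icc compact_continuous_image continuous_on_subset subset_UNIV)
  then obtain B where B: "\<And>t. t \<in> {0..P} \<Longrightarrow> norm (x t) \<le> B"
    using compact_imp_bounded by (metis bounded_iff imageI)
  have shift: "x (t + of_int k * P) = x t" for t and k :: int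
  proof (induction k rule: int_induct[where k = 0])
    case (step1 i)
    then show ?case using P(2)[of "t + of_int i * P"] by (simp add: algebra_simps)
  next
    case (step2 i)
    then show ?case using P(2)[of "t + of_int (i - 1) * P"] by (simp add: algebra_simps)
  qed simp
  have "norm (x t) \<le> B" for t
  proof -
    have "t - of_int \<lfloor>t / P\<rfloor> * P \<in> {0..P}"
      using floor_divide_lower[OF P(1), of t] floor_divide_upper[OF P(1), of t]
      by (auto simp: algebra_simps)
    then show ?thesis using B shift[of t "- \<lfloor>t / P\<rfloor>"] by fastforce
  qed
  then show ?thesis by (rule bdd_aboveI2)
qed

lemma hopf_branch_small_member:
  assumes "hopf_branch f \<Lambda> x P" "\<delta> > 0"
  obtains s where "s \<in> {0<..1}" "\<bar>\<Lambda> s\<bar> < \<delta>" "\<forall>t. norm (x s t) < \<delta>"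
proof -
  have "eventually (\<lambda>s. \<bar>\<Lambda> s\<bar> < \<delta>) (at_right 0)"
    "eventually (\<lambda>s. \<bar>SUP t. norm (x s t)\<bar> < \<delta>) (at_right 0)"
    using assms by (auto simp: hopf_branch_def dest!: tendstoD[where e = \<delta>])
  moreover have "eventually (\<lambda>s. s \<in> {0<..1::real}) (at_right 0)"
    by (auto simp: eventually_at_right_field intro!: exI[of _ 1])
  ultimately have "eventually (\<lambda>s. \<bar>\<Lambda> s\<bar> < \<delta> \<and> \<bar>SUP t. norm (x s t)\<bar> < \<delta> \<and> s \<in> {0<..1}) (at_right 0)"
    by eventually_elim simp
  from eventually_happens'[OF trivial_limit_at_right_real this]
  obtain s where s: "\<bar>\<Lambda> s\<bar> < \<delta>" "\<bar>SUP t. norm (x s t)\<bar> < \<delta>" "s \<in> {0<..1}"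
    by blast
  have "norm (x s t) \<le> (SUP t. norm (x s t))" for t
    using assms(1) s(3) by (intro cSUP_upper bdd_above_norm_periodic_solution) (auto simp: hopf_branch_def)
  then have "norm (x s t) < \<delta>" for t
    using s(2) by (meson abs_ge_self le_less_trans)
  then show thesis using s by (intro that[of s]) auto
qed

text \<open>The group enters through coordinate half turns and elements carrying any coordinate to
  any other, which pin down the linearisation, and through an element \<open>n\<close> reversing the
  fixed line. The contradiction is that \<open>n\<close> preserves the trajectory, so lies in H = K,
  without fixing \<open>w\<close>.\<close>

lemma not_occurs_on_line:
  fixes G :: "(complex^3^3, 'm) monoid_scheme"
  defines "K w \<equiv> {g\<in>carrier G. g *v w = w}"
  assumes refl: "\<And>i. \<exists>g\<in>carrier G. \<forall>z j. (g *v z) $ j = (if j = i then z $ j else - (z $ j))"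
    and perm: "\<And>i j. \<exists>g\<in>carrier G. \<forall>z. (g *v z) $ i = z $ j"
    and w: "w \<noteq> 0" and line: "\<And>z. (\<And>g. g \<in> K w \<Longrightarrow> g *v z = z) \<Longrightarrow> \<exists>c. z = c *s w"
    and n: "n \<in> carrier G" "n *v w = - w"
  shows "\<not> occurs_at_primary_hopf G (*v) (K w) (K w)"
proof
  assume "occurs_at_primary_hopf G (*v) (K w) (K w)"
  then obtain f \<Lambda> x P where fam: "hopf_family G (*v) f" and branch: "hopf_branch f \<Lambda> x P"
    and spt: "\<And>s. s \<in> {0<..1} \<Longrightarrow> spatiotemporal_symmetries G (*v) (x s) = K w"
    and spatial: "\<And>s. s \<in> {0<..1} \<Longrightarrow> spatial_symmetries G (*v) (x s) = K w"
    unfolding occurs_at_primary_hopf_def by blast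
  have smooth: "smooth_map f" and f0: "\<And>lam. f (0, lam) = 0"
    and equi: "\<And>g y lam. g \<in> carrier G \<Longrightarrow> f (g *v y, lam) = g *v f (y, lam)"
    using fam by (auto simp: hopf_family_def)
  define L where "L = frechet_derivative (\<lambda>y. f (y, 0)) (at 0)"
  have derL: "((\<lambda>y. f (y, 0)) has_derivative L) (at 0)"
    using smooth_linear_approximation[OF smooth zero_less_one] unfolding L_def by blast
  then have linL: "linear L" by (rule has_derivative_linear)
  have commL: "L (g *v y) = g *v L y" if g: "g \<in> carrier G" for g y
  proof -
    have lin_g: "linear ((*v) g)"
      by (rule linearI) (simp_all add: matrix_vector_right_distrib matrix_vector_smult flip: vector_smult_eq_scaleR)
    then have der_g: "((*v) g has_derivative (*v) g) F" for F
      by (simp add: linear_imp_has_derivative)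
    have "((\<lambda>y. f (g *v y, 0)) has_derivative (\<lambda>v. L (g *v v))) (at 0)"
      using diff_chain_at[OF der_g, of "\<lambda>y. f (y, 0)" L 0] derL by (simp add: o_def)
    moreover have "((\<lambda>y. g *v f (y, 0)) has_derivative (\<lambda>v. g *v L v)) (at 0)"
      using diff_chain_at[OF derL der_g] by (simp add: o_def)
    ultimately have "(\<lambda>v. L (g *v v)) = (\<lambda>v. g *v L v)"
      unfolding equi[OF g] by (rule has_derivative_unique)
    then show ?thesis by (rule fun_cong)
  qed
  obtain m where m: "linear m" and Lm: "\<And>y i. L y $ i = m (y $ i)"
    using commuting_map_componentwise[of L "carrier G", OF linL commL refl perm] by blast
  obtain \<sigma> \<rho> where "\<sigma> 0 = 0" "\<rho> 0 = 1"
    "\<And>lam. let L = frechet_derivative (\<lambda>x. f (x, lam)) (at 0) in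
       eigenvalue_multiplicity L (Complex (\<sigma> lam) (\<rho> lam)) = 3"
    using fam unfolding hopf_family_def Let_def by blast
  then have "eigenvalue_multiplicity L (Complex 0 1) = 3" unfolding L_def Let_def by metis
  moreover have "Complex 0 1 = \<i>" by (simp add: complex_eq_iff)
  ultimately have "eigenvalue_multiplicity L \<i> \<noteq> 0" by simp
  with linL obtain x0 where x0: "x0 \<noteq> 0" "L (L x0) = - x0" by (rule imaginary_unit_eigenvalue)
  then obtain j0 where "x0 $ j0 \<noteq> 0" by (auto simp: vec_eq_iff)
  moreover have "m (m (x0 $ j0)) = - (x0 $ j0)" by (metis Lm x0(2) vector_uminus_component)
  ultimately have mm: "m (m c) = - c" for c by (rule square_minus_one_if_vector[OF m])
  obtain l where l: "linear l" "inj l" and lm: "\<And>c. l (m c) = \<i> * l c"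
    using complexifying_functional[OF m mm] by blast
  obtain B where B: "B > 0" "\<And>c. B * norm c \<le> norm (l c)"
    using linear_inj_bounded_below_pos[OF l] by blast
  obtain M where M: "M > 0" "\<And>c. norm (l c) \<le> M * norm c"
    using linear_bounded_pos[OF l(1)] by blast
  obtain j where j: "w $ j \<noteq> 0" using w by (auto simp: vec_eq_iff)
  \<comment> \<open>On the line of \<open>w\<close> the full norm is \<open>\<kappa>\<close> times
    the norm of coordinate \<open>j\<close>.\<close>
  define \<kappa> where "\<kappa> = norm w / norm (w $ j)"
  have "\<kappa> > 0" using w j by (simp add: \<kappa>_def)
  \<comment> \<open>Chosen so that \<open>M * \<epsilon> * \<kappa> = B / 2\<close>: the error seen
    through \<open>l\<close> is then at most half of \<open>norm (p t)\<close>.\<close>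
  define \<epsilon> where "\<epsilon> = B / (2 * M * \<kappa>)"
  have "\<epsilon> > 0" using B M \<open>\<kappa> > 0\<close> by (simp add: \<epsilon>_def)
  obtain \<delta> where \<delta>: "\<delta> > 0" and approx: "\<forall>lam a b. \<bar>lam\<bar> < \<delta> \<and> norm a < \<delta> \<and> norm b < \<delta> \<longrightarrow>
      norm (f (a, lam) - f (b, lam) - L (a - b)) \<le> \<epsilon> * norm (a - b)"
      "((\<lambda>y. f (y, 0)) has_derivative L) (at 0)"
    by (rule smooth_linear_approximation[OF smooth \<open>\<epsilon> > 0\<close>, folded L_def])
  obtain s where s: "s \<in> {0<..1}" "\<bar>\<Lambda> s\<bar> < \<delta>" "\<forall>t. norm (x s t) < \<delta>"
    by (rule hopf_branch_small_member[OF branch \<delta>])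
  define F where "F = (\<lambda>y. f (y, \<Lambda> s))"
  define y where "y = x s"
  have "periodic_solution F y (P s)"
    using branch s(1) unfolding hopf_branch_def F_def y_def by blast
  then have P: "0 < P s" "\<And>t. y (t + P s) = y t" and sol: "\<And>t. (y has_vector_derivative F (y t)) (at t)"
    and minimal: "\<And>Q. 0 < Q \<Longrightarrow> Q < P s \<Longrightarrow> \<exists>t. y (t + Q) \<noteq> y t"
    unfolding periodic_solution_def by blast+
  have small: "norm (y t) < \<delta>" for t by (simp add: y_def s)
  have near: "norm (F a - F b - L (a - b)) \<le> \<epsilon> * norm (a - b)"
    if "norm a < \<delta>" "norm b < \<delta>" for a b
    using approx s(2) that by (simp add: F_def)
  obtain N where N: "\<And>v. norm (L v) \<le> N * norm v" using linear_bounded[OF linL] by blast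
  have lip: "norm (F a - F b) \<le> (\<epsilon> + N) * norm (a - b)" if "norm a < \<delta>" "norm b < \<delta>" for a b
    using near[OF that] N[of "a - b"] norm_triangle_sub[of "F a - F b" "L (a - b)"]
    by (simp add: algebra_simps)
  have F0: "F 0 = 0" by (simp add: F_def f0)
  have on_line: "\<exists>c. y t = c *s w" for t
  proof (rule line)
    fix g assume "g \<in> K w"
    then show "g *v y t = y t" using spatial[OF s(1)] by (auto simp: spatial_symmetries_def y_def)
  qed
  have y_eq: "y t = (y t $ j / w $ j) *s w" for t
    using on_line[of t] j by (auto simp: vec_eq_iff)
  have ny: "norm (y t) = \<kappa> * norm (y t $ j)" for t
    by (subst y_eq) (simp add: norm_vector_smult norm_divide \<kappa>_def)
  \<comment> \<open>On the line one coordinate determines the point, and through \<open>l\<close>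
    the linearised motion becomes multiplication by \<open>\<i>\<close>.\<close>
  define p where "p t = l (y t $ j)" for t
  have dp: "(p has_vector_derivative l (F (y t) $ j)) (at t)" for t
    unfolding p_def
    by (intro bounded_linear.has_vector_derivative[OF linear_conv_bounded_linear[THEN iffD1, OF l(1)]]
        bounded_linear.has_vector_derivative[OF bounded_linear_vec_nth] sol)
  have rot: "norm (l (F (y t) $ j) - \<i> * p t) \<le> norm (p t) / 2" for t
  proof -
    have "l (F (y t) $ j) - \<i> * p t = l ((F (y t) - L (y t)) $ j)"
      by (simp add: p_def lm Lm linear_diff[OF l(1)])
    also have "norm \<dots> \<le> M * norm ((F (y t) - L (y t)) $ j)" by (rule M)
    also have "\<dots> \<le> M * (\<epsilon> * norm (y t))"
      using near[OF small, of 0 t] \<delta> M(1) Finite_Cartesian_Product.norm_nth_le[of "F (y t) - L (y t)" j] F0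
      by (intro mult_left_mono) auto
    also have "\<dots> = B * norm (y t $ j) / 2"
      using M(1) \<open>\<kappa> > 0\<close> by (simp add: ny \<epsilon>_def)
    also have "\<dots> \<le> norm (p t) / 2" using B(2) by (simp add: p_def)
    finally show ?thesis .
  qed
  \<comment> \<open>A visit to the equilibrium 0 would make the solution constant, so that half the
    period would be a period too.\<close>
  have "p t \<noteq> 0" for t
  proof
    assume "p t = 0"
    then have "y t $ j = 0" using l by (simp add: p_def linear_injective_0)
    then have "y t = 0" using ny[of t] by simp
    then have "y r = 0" for r
      using linear_growth_zero[of y "\<lambda>t. F (y t)" "\<epsilon> + N" t r] sol lip[OF small, of 0] \<delta> F0 by simp
    then show False using minimal[of "P s / 2"] P(1) by simp
  qed
  then obtain t t' where "p t' = - p t"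
    using rotating_periodic_meets_antipode[of p _ "P s", OF dp rot P(1)] P(2) by (auto simp: p_def)
  then have antipode: "y t' $ j = - (y t $ j)"
    using l by (simp add: p_def linear_neg[OF l(1), symmetric] inj_eq)
  have ny_neg: "n *v y t = - y t" for t
    by (subst (1 2) y_eq) (simp add: matrix_vector_smult n vec_eq_iff)
  have "y t' = - ((y t $ j / w $ j) *s w)"
    by (subst y_eq) (simp add: antipode vec_eq_iff)
  then have "y t' = n *v y t"
    by (simp only: y_eq[symmetric] ny_neg)
  \<comment> \<open>By equivariance \<open>n\<close> maps \<open>y\<close> to a solution of the same
    equation; the two share a point and hence the whole orbit.\<close>
  have meet: "y (t' + r) = n *v y (t + r)" for r
  proof (rule orbits_equal_if_meet[where F = F and C = "\<epsilon> + N" and z = "\<lambda>t. n *v y t"])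
    fix t r
    have "((\<lambda>t. n *v y t) has_vector_derivative n *v F (y t)) (at t)"
      by (rule bounded_linear.has_vector_derivative[OF _ sol]) (rule matrix_vector_mul_bounded_linear)
    then show "((\<lambda>t. n *v y t) has_vector_derivative F (n *v y t)) (at t)"
      by (simp add: F_def equi n)
    show "norm (F (y r) - F (n *v y t)) \<le> (\<epsilon> + N) * norm (y r - n *v y t)"
      by (rule lip) (simp_all add: small ny_neg)
  qed (simp_all add: sol \<open>y t' = n *v y t\<close>)
  have "(*v) n ` range y = range y"
  proof (intro equalityI subsetI)
    fix z assume "z \<in> (*v) n ` range y"
    then obtain r where "z = n *v y (t + (r - t))" by auto
    then show "z \<in> range y" unfolding meet[symmetric] by simp
  next
    fix z assume "z \<in> range y"
    then obtain r where "z = y (t' + (r - t'))" by auto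
    then show "z \<in> (*v) n ` range y" unfolding meet by simp
  qed
  then have "n \<in> K w"
    using spt[OF s(1)] n(1) by (auto simp: spatiotemporal_symmetries_def y_def)
  then have "w = - w" using n(2) by (simp add: K_def)
  then show False using w by (auto simp: vec_eq_iff)
qed

section \<open>The elements of the octahedral group\<close>

text \<open>Integer matrices are represented by triples of rows, so that statements about all group
  elements are decided by rewriting with numerals.\<close>

type_synonym 'a triple = "'a \<times> 'a \<times> 'a"

fun tdot :: "int triple \<Rightarrow> int triple \<Rightarrow> int" where
  "tdot (a, b, c) (x, y, z) = a * x + b * y + c * z"

fun tmv :: "int triple triple \<Rightarrow> int triple \<Rightarrow> int triple" where
  "tmv (r, s, t) v = (tdot r v, tdot s v, tdot t v)"

fun ttr :: "int triple triple \<Rightarrow> int triple triple" where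
  "ttr ((a, b, c), (d, e, f), (g, h, i)) = ((a, d, g), (b, e, h), (c, f, i))"

definition tmm :: "int triple triple \<Rightarrow> int triple triple \<Rightarrow> int triple triple" where
  "tmm A B = (case ttr B of (x, y, z) \<Rightarrow> ttr (tmv A x, tmv A y, tmv A z))"

fun tvec :: "int triple \<Rightarrow> complex^3" where
  "tvec (a, b, c) = vector [of_int a, of_int b, of_int c]"

fun tmat :: "int triple triple \<Rightarrow> complex^3^3" where
  "tmat ((a, b, c), (d, e, f), (g, h, i)) =
     vector [vector [of_int a, of_int b, of_int c], vector [of_int d, of_int e, of_int f],
       vector [of_int g, of_int h, of_int i]]"

definition tI :: "int triple triple" where "tI = ((1,0,0),(0,1,0),(0,0,1))"
definition tC :: "int triple triple" where "tC = ((0,1,0),(0,0,1),(1,0,0))"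
definition tT :: "int triple triple" where "tT = ((0,1,0),(-1,0,0),(0,0,1))"

lemmas tmm_simps = tmm_def tI_def tC_def tT_def

lemma tmat_tmm: "tmat (tmm A B) = tmat A ** tmat B"
  by (cases A; cases B)
    (auto simp: tmm_def vec_eq_iff forall_3 matrix_matrix_mult_def sum_3)

lemma tvec_tmv: "tvec (tmv A v) = tmat A *v tvec v"
  by (cases A; cases v) (auto simp: vec_eq_iff forall_3 matrix_vector_mult_def sum_3)

lemma inj_tmat: "inj tmat"
  by (rule injI) (auto simp: vec_eq_iff forall_3)

lemma inj_tvec: "inj tvec"
  by (rule injI) (auto simp: vec_eq_iff forall_3)

lemma tmat_tI: "tmat tI = mat 1"
  by (auto simp: tI_def vec_eq_iff forall_3 mat_def)

lemma tmat_tC: "tmat tC = C_mat" and tmat_tT: "tmat tT = T_mat"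
  by (simp_all add: tC_def tT_def C_mat_def T_mat_def)

section \<open>The 24 rotations as words in the generators\<close>

text \<open>One word for each element. Keeping the words and not only their products shows that
  every element is generated, and gives an induction over left multiplication by a
  generator.\<close>

definition octa_words :: "int triple triple list list" where
  "octa_words = [[],
   [tC],
   [tT],
   [tC,tC],
   [tT,tC],
   [tC,tT],
   [tT,tT],
   [tT,tC,tC],
   [tC,tT,tC],
   [tT,tT,tC],
   [tC,tC,tT],
   [tC,tT,tT],
   [tC,tT,tC,tC],
   [tT,tT,tC,tC],
   [tC,tC,tT,tC],
   [tC,tT,tT,tC],
   [tT,tC,tC,tT],
   [tC,tC,tT,tT],
   [tC,tC,tT,tC,tC],
   [tC,tT,tT,tC,tC],
   [tC,tC,tT,tT,tC],
   [tT,tT,tC,tC,tT],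
   [tT,tC,tC,tT,tT],
   [tT,tC,tC,tT,tT,tC]]"

definition octa :: "int triple triple list" where
  "octa = map (\<lambda>w. foldr tmm w tI) octa_words"

lemma octa_eq: "octa = [((1,0,0),(0,1,0),(0,0,1)),
   ((0,1,0),(0,0,1),(1,0,0)),
   ((0,1,0),(-1,0,0),(0,0,1)),
   ((0,0,1),(1,0,0),(0,1,0)),
   ((0,0,1),(0,-1,0),(1,0,0)),
   ((-1,0,0),(0,0,1),(0,1,0)),
   ((-1,0,0),(0,-1,0),(0,0,1)),
   ((1,0,0),(0,0,-1),(0,1,0)),
   ((0,-1,0),(1,0,0),(0,0,1)),
   ((0,-1,0),(0,0,-1),(1,0,0)),
   ((0,0,1),(0,1,0),(-1,0,0)),
   ((0,-1,0),(0,0,1),(-1,0,0)),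
   ((0,0,-1),(0,1,0),(1,0,0)),
   ((0,0,-1),(-1,0,0),(0,1,0)),
   ((1,0,0),(0,0,1),(0,-1,0)),
   ((0,0,-1),(1,0,0),(0,-1,0)),
   ((0,1,0),(0,0,-1),(-1,0,0)),
   ((0,0,1),(-1,0,0),(0,-1,0)),
   ((0,1,0),(1,0,0),(0,0,-1)),
   ((-1,0,0),(0,1,0),(0,0,-1)),
   ((1,0,0),(0,-1,0),(0,0,-1)),
   ((0,0,-1),(0,-1,0),(-1,0,0)),
   ((-1,0,0),(0,0,-1),(0,-1,0)),
   ((0,-1,0),(-1,0,0),(0,0,-1))]"
  by (simp add: octa_def octa_words_def tmm_simps)

lemma octa_induct [consumes 1, case_names I C T]:
  assumes "A \<in> set octa" "Q tI" "\<And>A. Q A \<Longrightarrow> Q (tmm tC A)" "\<And>A. Q A \<Longrightarrow> Q (tmm tT A)"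
  shows "Q A"
proof -
  have "Q (foldr tmm w tI)" if "set w \<subseteq> {tC, tT}" for w
    using that by (induction w) (auto intro: assms)
  moreover have "\<forall>w\<in>set octa_words. set w \<subseteq> {tC, tT}" by (simp add: octa_words_def)
  ultimately show ?thesis using assms(1) by (auto simp: octa_def)
qed

lemma tI_in_octa: "tI \<in> set octa"
  by (simp add: octa_eq tI_def)

lemma tmm_generator_in_octa:
  assumes "A \<in> set octa"
  shows "tmm tC A \<in> set octa" "tmm tT A \<in> set octa"
proof -
  have "\<forall>A\<in>set octa. tmm tC A \<in> set octa" "\<forall>A\<in>set octa. tmm tT A \<in> set octa"
    by (simp_all add: octa_eq tmm_simps)
  then show "tmm tC A \<in> set octa" "tmm tT A \<in> set octa" using assms by blast+
qed

lemma tmm_assoc: "tmm (tmm A B) C = tmm A (tmm B C)"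
  by (rule injD[OF inj_tmat]) (simp add: tmat_tmm matrix_mul_assoc)

lemma tmm_tI: "tmm tI A = A" "tmm A tI = A"
  by (rule injD[OF inj_tmat], simp add: tmat_tmm tmat_tI)+

text \<open>Induction on the word of \<open>A\<close> reduces closure to left multiplication by a
  generator: 48 products in place of 576.\<close>

lemma tmm_in_octa:
  assumes "A \<in> set octa" "B \<in> set octa"
  shows "tmm A B \<in> set octa"
  using assms(1) by (induction A rule: octa_induct)
    (auto simp: tmm_tI assms(2) tmm_assoc intro: tmm_generator_in_octa)

lemma distinct_octa: "distinct octa"
  by (simp add: octa_eq)

text \<open>Representatives of the conjugacy classes of non-trivial rotations: \<open>tR4\<close> and \<open>tR4sq\<close> about a
  face axis, \<open>tC\<close> about a diagonal, \<open>tR2\<close> about an edge axis.\<close>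

definition tR4 :: "int triple triple" where "tR4 = ((1,0,0),(0,0,-1),(0,1,0))"
definition tR4sq :: "int triple triple" where "tR4sq = ((1,0,0),(0,-1,0),(0,0,-1))"
definition tR2 :: "int triple triple" where "tR2 = ((-1,0,0),(0,0,1),(0,1,0))"

lemmas rotation_defs = tR4_def tR4sq_def tR2_def tC_def

lemma octa_conjugacy:
  assumes "A \<in> set octa" "A \<noteq> tI"
  obtains g R where "g \<in> set octa" "R \<in> {tR4, tR4sq, tC, tR2}" "tmm A g = tmm g R"
proof -
  \<comment> \<open>Witnesses in the order of \<open>tl octa\<close>: an entry (k, R) records that
    \<open>octa ! k\<close> conjugates \<open>R\<close> to the element A at that position. The
    relation is checked in the form A g = g R, free of inverses.\<close>
  define table :: "(nat \<times> int triple triple) list" where "table = [(0, tC), (10, tR4), (21, tC), (2, tR2), (0, tR2), (1, tR4sq), (0, tR4), (1, tR4), (11, tC), (3, tR4), (16, tC), (2, tR4), (5, tC), (5, tR4), (10, tC), (6, tC), (2, tC), (1, tR2), (2, tR4sq), (0, tR4sq), (8, tR2), (6, tR2), (4, tR2)]"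
  have *: "list_all2 (\<lambda>A (k, R). tmm A (octa ! k) = tmm (octa ! k) R) (tl octa) table"
    by (simp add: octa_eq table_def tmm_simps rotation_defs)
  have "A \<in> set (tl octa)" using assms by (auto simp: octa_eq tI_def)
  then obtain i where i: "i < length (tl octa)" "A = tl octa ! i" by (metis in_set_conv_nth)
  obtain k R where "table ! i = (k, R)" by (cases "table ! i")
  then have kR: "(k, R) \<in> set table" "tmm A (octa ! k) = tmm (octa ! k) R"
    using list_all2_nthD[OF * i(1)] nth_mem[of i table] list_all2_lengthD[OF *] i by auto
  have "\<forall>(k, R)\<in>set table. k < length octa \<and> R \<in> {tR4, tR4sq, tC, tR2}"
    by (simp add: octa_eq table_def)
  then have "k < length octa" "R \<in> {tR4, tR4sq, tC, tR2}" using kR(1) by blast+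
  then show thesis using kR(2) that nth_mem by blast
qed

text \<open>Stabilisers of a face, a diagonal and an edge direction, decided by filtering the
  explicit list. \<open>tmm tR4 tR4sq\<close> is the inverse quarter turn.\<close>

lemma octa_stabilizers:
  "{A \<in> set octa. tmv A (1, 0, 0) = (1, 0, 0)} = {tI, tR4, tmm tR4 tR4sq, tR4sq}"
  "{A \<in> set octa. tmv A (1, 1, 1) = (1, 1, 1)} = {tI, tC, tmm tC tC}"
  "{A \<in> set octa. tmv A (0, 1, 1) = (0, 1, 1)} = {tI, tR2}"
proof -
  have "filter (\<lambda>A. tmv A (1, 0, 0) = (1, 0, 0)) octa = [tI, tR4, tmm tR4 tR4sq, tR4sq]"
    "filter (\<lambda>A. tmv A (1, 1, 1) = (1, 1, 1)) octa = [tI, tC, tmm tC tC]"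
    "filter (\<lambda>A. tmv A (0, 1, 1) = (0, 1, 1)) octa = [tI, tR2]"
    by (simp_all add: octa_eq tmm_simps rotation_defs)
  from this[THEN arg_cong[where f = set]] show
    "{A \<in> set octa. tmv A (1, 0, 0) = (1, 0, 0)} = {tI, tR4, tmm tR4 tR4sq, tR4sq}"
    "{A \<in> set octa. tmv A (1, 1, 1) = (1, 1, 1)} = {tI, tC, tmm tC tC}"
    "{A \<in> set octa. tmv A (0, 1, 1) = (0, 1, 1)} = {tI, tR2}"
    by (simp_all only: set_filter list.set)
qed

text \<open>Source of the element acting as -1 on a fixed line: a half turn about a perpendicular
  axis reverses the direction.\<close>

lemma octa_reverses_axis:
  "\<exists>A\<in>set octa. tmv A (1, 0, 0) = (-1, 0, 0)"
  "\<exists>A\<in>set octa. tmv A (1, 1, 1) = (-1, -1, -1)"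
  "\<exists>A\<in>set octa. tmv A (0, 1, 1) = (0, -1, -1)"
  by (simp_all add: octa_eq)

section \<open>The matrix group and its action\<close>

lemma group_GL3: "group GL3"
proof (rule groupI)
  fix A :: "complex^3^3" assume "A \<in> carrier GL3"
  then obtain B where "A ** B = mat 1" "B ** A = mat 1" by (auto simp: GL3_def invertible_def)
  then show "\<exists>B\<in>carrier GL3. B \<otimes>\<^bsub>GL3\<^esub> A = \<one>\<^bsub>GL3\<^esub>"
    by (auto simp: GL3_def invertible_def)
qed (auto simp: GL3_def invertible_mult matrix_mul_assoc[symmetric] invertible_def[of "mat 1"])

lemma generators_in_GL3: "{C_mat, T_mat} \<subseteq> carrier GL3"
proof -
  have "tmm tC (tmm tC tC) = tI" "tmm tT (tmm tT (tmm tT tT)) = tI"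
    "tmm (tmm tC tC) tC = tI" "tmm (tmm tT (tmm tT tT)) tT = tI"
    by (simp_all add: tmm_simps)
  from this[THEN arg_cong[where f = tmat]] show ?thesis
    by (auto simp: GL3_def invertible_def tmat_tmm tmat_tI tmat_tC tmat_tT)
qed

lemma group_octahedral: "group octahedral_group"
  unfolding octahedral_group_def
  by (rule group.subgroup_imp_group[OF group_GL3 group.generate_is_subgroup[OF group_GL3 generators_in_GL3]])

lemma mult_octahedral [simp]: "A \<otimes>\<^bsub>octahedral_group\<^esub> B = A ** B"
  and one_octahedral [simp]: "\<one>\<^bsub>octahedral_group\<^esub> = mat 1"
  by (simp_all add: octahedral_group_def GL3_def)

lemma carrier_octahedral: "carrier octahedral_group = tmat ` set octa"
proof
  interpret G: group GL3 by (rule group_GL3)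
  have "A \<in> tmat ` set octa" if "A \<in> generate GL3 {C_mat, T_mat}" for A
    using that
  proof (induction rule: generate.induct)
    case one
    then show ?case using tI_in_octa by (simp add: GL3_def flip: tmat_tI)
  next
    case (incl h)
    have "tmm tC tI \<in> set octa" "tmm tT tI \<in> set octa"
      by (intro tmm_generator_in_octa tI_in_octa)+
    then show ?case using incl by (auto simp: tmm_tI simp flip: tmat_tC tmat_tT)
  next
    case (inv h)
    \<comment> \<open>C has order 3 and T has order 4, so the inverses of the generators are the
      positive powers C^2 and T^3, and words without inverses exhaust the group.\<close>
    have C: "tmm tC (tmm tC tI) \<in> set octa" and T: "tmm tT (tmm tT (tmm tT tI)) \<in> set octa"
      by (intro tmm_generator_in_octa tI_in_octa)+
    have "tmm (tmm tC (tmm tC tI)) tC = tI" "tmm (tmm tT (tmm tT (tmm tT tI))) tT = tI"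
      by (simp_all add: tmm_simps)
    from this[THEN arg_cong[where f = tmat]] C T
    have "inv\<^bsub>GL3\<^esub> C_mat = tmat (tmm tC (tmm tC tI))" "inv\<^bsub>GL3\<^esub> T_mat = tmat (tmm tT (tmm tT (tmm tT tI)))"
      using generators_in_GL3
      by (auto intro!: G.inv_equality simp: tmat_tmm tmat_tI tmat_tC tmat_tT)
         (auto simp: GL3_def intro!: invertible_mult simp: invertible_def[of "mat 1"])
    then show ?case using inv C T by auto
  next
    case (eng h1 h2)
    then obtain A B where "h1 = tmat A" "h2 = tmat B" "A \<in> set octa" "B \<in> set octa" by auto
    then show ?case using tmm_in_octa by (auto simp: GL3_def simp flip: tmat_tmm)
  qed
  then show "carrier octahedral_group \<subseteq> tmat ` set octa" by (auto simp: octahedral_group_def)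
  have "tmat A \<in> generate GL3 {C_mat, T_mat}" if "A \<in> set octa" for A
    using that
  proof (induction A rule: octa_induct)
    case I
    then show ?case using generate.one[of GL3 "{C_mat, T_mat}"] by (simp add: tmat_tI GL3_def)
  next
    case (C A)
    then show ?case using generate.eng[OF generate.incl[of C_mat "{C_mat, T_mat}" GL3]]
      by (auto simp: tmat_tmm tmat_tC GL3_def)
  next
    case (T A)
    then show ?case using generate.eng[OF generate.incl[of T_mat "{C_mat, T_mat}" GL3]]
      by (auto simp: tmat_tmm tmat_tT GL3_def)
  qed
  then show "tmat ` set octa \<subseteq> carrier octahedral_group" by (auto simp: octahedral_group_def)
qed

lemma card_octahedral: "card (carrier octahedral_group) = 24"
proof -
  have "card (set octa) = 24" using distinct_card[OF distinct_octa] by (simp add: octa_eq)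
  then show ?thesis unfolding carrier_octahedral
    by (subst card_image) (auto intro: inj_on_subset[OF inj_tmat])
qed

lemma matrix_vector_generators:
  "C_mat *v z = vector [z $ 2, z $ 3, z $ 1]" "T_mat *v z = vector [z $ 2, - (z $ 1), z $ 3]"
  by (simp_all add: C_mat_def T_mat_def vec_eq_iff forall_3 matrix_vector_mult_def sum_3)

text \<open>Reduces equivariance and isometry claims to the two generators.\<close>

lemma octahedral_induct [consumes 1, case_names one C T]:
  assumes "g \<in> carrier octahedral_group" "Q (mat 1)"
    "\<And>g. Q g \<Longrightarrow> Q (C_mat ** g)" "\<And>g. Q g \<Longrightarrow> Q (T_mat ** g)"
  shows "Q g"
proof -
  obtain A where "A \<in> set octa" "g = tmat A" using assms(1) by (auto simp: carrier_octahedral)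
  then show ?thesis
    by (induction A arbitrary: g rule: octa_induct)
      (auto simp: tmat_tI tmat_tmm tmat_tC tmat_tT intro: assms)
qed

lemma norm_octahedral:
  assumes "g \<in> carrier octahedral_group"
  shows "norm (g *v z) = norm z"
  using assms
proof (induction g rule: octahedral_induct)
  case (C g)
  have "norm (C_mat *v y) = norm y" for y
    by (simp add: norm_vec_def L2_set_def sum_3 matrix_vector_generators add.commute add.left_commute)
  then show ?case using C by (simp flip: matrix_vector_mul_assoc)
next
  case (T g)
  have "norm (T_mat *v y) = norm y" for y
    by (simp add: norm_vec_def L2_set_def sum_3 matrix_vector_generators add.commute add.left_commute)
  then show ?case using T by (simp flip: matrix_vector_mul_assoc)
qed simp

text \<open>The cross product of the conjugate of \<open>v\<close> with \<open>v\<close>: up to a factor, the normal vector of the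
  plane spanned by the real and imaginary parts of \<open>v\<close>. It is invariant under phase shifts of \<open>v\<close>,
  so an element of the group that moves \<open>v\<close> by a phase must fix this normal vector.\<close>

definition plane_axis :: "complex^3 \<Rightarrow> complex^3" where
  "plane_axis v = vector [cnj (v$2) * v$3 - cnj (v$3) * v$2, cnj (v$3) * v$1 - cnj (v$1) * v$3,
     cnj (v$1) * v$2 - cnj (v$2) * v$1]"

text \<open>Rotations commute with the cross product and real matrices with conjugation.\<close>

lemma plane_axis_octahedral:
  assumes "g \<in> carrier octahedral_group"
  shows "plane_axis (g *v v) = g *v plane_axis v"
  using assms
proof (induction g rule: octahedral_induct)
  case (C g)
  have "plane_axis (C_mat *v y) = C_mat *v plane_axis y" for y
    by (simp add: matrix_vector_generators plane_axis_def)
  then show ?case using C by (simp flip: matrix_vector_mul_assoc)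
next
  case (T g)
  have "plane_axis (T_mat *v y) = T_mat *v plane_axis y" for y
    by (simp add: matrix_vector_generators plane_axis_def)
  then show ?case using T by (simp flip: matrix_vector_mul_assoc)
qed simp

lemma norm_phase_octahedral:
  assumes "g \<in> carrier octahedral_group" "g *v v = c *s v" "v \<noteq> 0"
  shows "norm c = 1"
  using norm_octahedral[OF assms(1), of v] assms(2,3) by (simp add: norm_vector_smult)

lemma phase_fixes_plane_axis:
  assumes "g \<in> carrier octahedral_group" "g *v v = c *s v" "v \<noteq> 0"
  shows "g *v plane_axis v = plane_axis v"
proof -
  have "cnj c * c = 1"
    using norm_phase_octahedral[OF assms] by (simp add: complex_norm_square[symmetric] mult.commute)
  moreover have "cnj (c * a) * (c * b) = (cnj c * c) * (cnj a * b)" for a b by simp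
  ultimately have "cnj (c * a) * (c * b) = cnj a * b" for a b by (metis mult_1)
  then have "plane_axis (c *s v) = plane_axis v"
    by (simp only: plane_axis_def vector_smult_component)
  then show ?thesis by (metis assms(1,2) plane_axis_octahedral)
qed

lemma inv_octahedral:
  assumes "g \<in> carrier octahedral_group"
  shows "inv\<^bsub>octahedral_group\<^esub> g \<in> carrier octahedral_group"
    and "inv\<^bsub>octahedral_group\<^esub> g ** g = mat 1" "g ** inv\<^bsub>octahedral_group\<^esub> g = mat 1"
    and "inv\<^bsub>octahedral_group\<^esub> g *v (g *v v) = v" "g *v (inv\<^bsub>octahedral_group\<^esub> g *v v) = v"
proof -
  interpret group octahedral_group by (rule group_octahedral)
  show *: "inv\<^bsub>octahedral_group\<^esub> g ** g = mat 1" "g ** inv\<^bsub>octahedral_group\<^esub> g = mat 1"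
    using l_inv[OF assms] r_inv[OF assms] by simp_all
  show "inv\<^bsub>octahedral_group\<^esub> g *v (g *v v) = v" "g *v (inv\<^bsub>octahedral_group\<^esub> g *v v) = v"
    by (simp_all add: matrix_vector_mul_assoc *)
qed (simp add: assms group.inv_closed[OF group_octahedral])

lemma mult_closed_octahedral:
  "g \<in> carrier octahedral_group \<Longrightarrow> h \<in> carrier octahedral_group \<Longrightarrow> g ** h \<in> carrier octahedral_group"
  using group_octahedral by (metis group.is_monoid monoid.m_closed mult_octahedral)

lemma conj_coset_eq:
  "g <#\<^bsub>octahedral_group\<^esub> H #>\<^bsub>octahedral_group\<^esub> inv\<^bsub>octahedral_group\<^esub> g =
   (\<lambda>h. g ** h ** inv\<^bsub>octahedral_group\<^esub> g) ` H"
  by (auto simp: l_coset_def r_coset_def)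

section \<open>Axes, phases and isotropy subgroups\<close>

text \<open>\<open>X = {1}\<close> gives the stabiliser of \<open>v\<close> and
  \<open>X = UNIV\<close> the elements preserving its complex line: the spatial and the
  spatio-temporal symmetries of the circular orbit through \<open>v\<close>. The parameter lets both
  be treated at once.\<close>

definition phase_group :: "complex set \<Rightarrow> complex^3 \<Rightarrow> (complex^3^3) set" where
  "phase_group X v = {h \<in> carrier octahedral_group. \<exists>c\<in>X. h *v v = c *s v}"

lemma conj_phase_group:
  assumes g: "g \<in> carrier octahedral_group"
  shows "(\<lambda>h. g ** h ** inv\<^bsub>octahedral_group\<^esub> g) ` phase_group X v = phase_group X (g *v v)"
proof (intro equalityI subsetI)
  fix k assume "k \<in> (\<lambda>h. g ** h ** inv\<^bsub>octahedral_group\<^esub> g) ` phase_group X v"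
  then show "k \<in> phase_group X (g *v v)"
    using g by (auto simp: phase_group_def inv_octahedral matrix_vector_smult mult_closed_octahedral
        simp flip: matrix_vector_mul_assoc)
next
  fix k assume k: "k \<in> phase_group X (g *v v)"
  let ?i = "inv\<^bsub>octahedral_group\<^esub> g"
  have "k = g ** (?i ** k ** g) ** ?i"
    by (metis inv_octahedral(3)[OF g] matrix_mul_assoc matrix_mul_lid matrix_mul_rid)
  moreover have "?i ** k ** g \<in> phase_group X v"
    using k g by (auto simp: phase_group_def inv_octahedral matrix_vector_smult mult_closed_octahedral
        simp flip: matrix_vector_mul_assoc intro!: bexI)
  ultimately show "k \<in> (\<lambda>h. g ** h ** ?i) ` phase_group X v" by blast
qed

lemma subgroup_phase_group:
  assumes "v \<noteq> 0" "X = UNIV \<or> X = {1}"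
  shows "subgroup (phase_group X v) octahedral_group"
proof
  fix g assume "g \<in> phase_group X v"
  then obtain c where g: "g \<in> carrier octahedral_group" "c \<in> X" "g *v v = c *s v"
    by (auto simp: phase_group_def)
  have "c \<noteq> 0" using norm_phase_octahedral[OF g(1,3) assms(1)] by auto
  have "v = c *s (inv\<^bsub>octahedral_group\<^esub> g *v v)"
    using arg_cong[OF g(3), of "(*v) (inv\<^bsub>octahedral_group\<^esub> g)"] g(1)
    by (simp add: inv_octahedral matrix_vector_smult)
  then have "(1 / c) *s v = (1 / c) *s (c *s (inv\<^bsub>octahedral_group\<^esub> g *v v))" by simp
  then have "inv\<^bsub>octahedral_group\<^esub> g *v v = (1 / c) *s v" using \<open>c \<noteq> 0\<close> by simp
  then show "inv\<^bsub>octahedral_group\<^esub> g \<in> phase_group X v"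
    using g assms(2) by (auto simp: phase_group_def inv_octahedral)
next
  fix g h assume "g \<in> phase_group X v" "h \<in> phase_group X v"
  then show "g \<otimes>\<^bsub>octahedral_group\<^esub> h \<in> phase_group X v"
    using assms(2) by (auto simp: phase_group_def mult_closed_octahedral matrix_vector_smult
        simp flip: matrix_vector_mul_assoc)
next
  have "mat 1 \<in> carrier octahedral_group" 
    by (metis group_octahedral group.is_monoid monoid.one_closed one_octahedral)
  moreover have "\<exists>c\<in>X. v = c *s v" using assms(2) by (intro bexI[of _ 1]) auto
  ultimately show "\<one>\<^bsub>octahedral_group\<^esub> \<in> phase_group X v" by (simp add: phase_group_def)
qed (auto simp: phase_group_def)

lemma phase_group_smult:
  assumes "c \<noteq> 0"
  shows "phase_group X (c *s v) = phase_group X v"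
proof -
  have "h *v (c *s v) = d *s (c *s v) \<longleftrightarrow> h *v v = d *s v" for h d
    using assms by (simp add: matrix_vector_smult vec_eq_iff)
  then show ?thesis by (simp add: phase_group_def)
qed

lemma phase_group_tvec:
  "phase_group {1} (tvec u) = tmat ` {A \<in> set octa. tmv A u = u}"
proof -
  have "tmat A *v tvec u = tvec u \<longleftrightarrow> tmv A u = u" for A
    using injD[OF inj_tvec, of "tmv A u" u] by (metis tvec_tmv)
  moreover have "phase_group {1} (tvec u) = {h \<in> tmat ` set octa. h *v tvec u = tvec u}"
    by (simp add: phase_group_def carrier_octahedral)
  ultimately show ?thesis by (simp only: Compr_image_eq)
qed

section \<open>Rotation axes and their stabilisers\<close>

text \<open>\<open>R\<close> need not generate the stabiliser of \<open>w\<close>, since half and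
  quarter turns about a face axis share their line. The last clause supplies the element acting as
  -1.\<close>

definition is_axis :: "complex^3^3 \<Rightarrow> complex^3 \<Rightarrow> bool" where
  "is_axis R w \<longleftrightarrow> R \<in> carrier octahedral_group \<and> w \<noteq> 0 \<and> R *v w = w \<and>
     (\<forall>z. R *v z = z \<longrightarrow> (\<exists>c. z = c *s w)) \<and> (\<exists>n\<in>carrier octahedral_group. n *v w = - w)"

lemma is_axis_conj:
  assumes g: "g \<in> carrier octahedral_group" and R: "is_axis R w"
  shows "is_axis (g ** R ** inv\<^bsub>octahedral_group\<^esub> g) (g *v w)"
  unfolding is_axis_def
proof (intro conjI allI impI)
  let ?i = "inv\<^bsub>octahedral_group\<^esub> g"
  show "g ** R ** ?i \<in> carrier octahedral_group" "g ** R ** ?i *v (g *v w) = g *v w"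
    using g R by (auto simp: is_axis_def mult_closed_octahedral inv_octahedral simp flip: matrix_vector_mul_assoc)
  show "g *v w \<noteq> 0" using R norm_octahedral[OF g, of w] by (auto simp: is_axis_def)
  obtain n where n: "n \<in> carrier octahedral_group" "n *v w = - w" using R by (auto simp: is_axis_def)
  then have "(g ** n ** ?i) *v (g *v w) = - (g *v w)"
    using g by (simp add: inv_octahedral vec.neg flip: matrix_vector_mul_assoc)
  then show "\<exists>n\<in>carrier octahedral_group. n *v (g *v w) = - (g *v w)"
    using g n by (intro bexI[of _ "g ** n ** ?i"]) (auto simp: mult_closed_octahedral inv_octahedral)
  fix z assume "g ** R ** ?i *v z = z"
  then have "?i *v (g *v (R *v (?i *v z))) = ?i *v z" by (simp flip: matrix_vector_mul_assoc)
  then obtain c where "?i *v z = c *s w" using R g by (auto simp: is_axis_def inv_octahedral)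
  then have "z = g *v (c *s w)" using g by (metis inv_octahedral(5))
  then show "\<exists>c. z = c *s (g *v w)" by (auto simp: matrix_vector_smult)
qed

lemma dim_complex_line:
  fixes w :: "complex^'n"
  assumes "w \<noteq> 0"
  shows "dim (range (\<lambda>c. c *s w)) = 2"
proof -
  obtain j where j: "w $ j \<noteq> 0" using assms by (auto simp: vec_eq_iff)
  have "range (\<lambda>c. c *s w) \<subseteq> span {w, \<i> *s w}"
  proof safe
    fix c
    have "c *s w = Re c *\<^sub>R w + Im c *\<^sub>R (\<i> *s w)"
      by (simp add: vec_eq_iff complex_eq_iff algebra_simps)
    then show "c *s w \<in> span {w, \<i> *s w}"
      by (simp add: span_add span_scale span_base)
  qed
  moreover have "{w, \<i> *s w} \<subseteq> range (\<lambda>c. c *s w)"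
    using image_eqI[of w "\<lambda>c. c *s w" 1 UNIV] by auto
  moreover have "\<i> *s w \<notin> span {w}"
  proof
    assume "\<i> *s w \<in> span {w}"
    then obtain k where "\<i> *s w = k *\<^sub>R w" by (auto simp: span_singleton)
    then have "\<i> * w $ j = of_real k * w $ j" by (metis vector_smult_component vector_smult_eq_scaleR)
    then have "\<i> = of_real k" using j by simp
    then show False by (simp add: complex_eq_iff)
  qed
  moreover from this have "\<i> *s w \<noteq> w" by (metis insertI1 span_base)
  ultimately have "independent {\<i> *s w, w}" "card {\<i> *s w, w} = 2"
    "{\<i> *s w, w} \<subseteq> range (\<lambda>c. c *s w)" "range (\<lambda>c. c *s w) \<subseteq> span {\<i> *s w, w}"
    using assms by (simp_all add: independent_insert insert_commute[of w])
  then show ?thesis by (intro dim_unique[of "{\<i> *s w, w}"])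
qed

lemma fix_space_axis:
  assumes "is_axis R w"
  shows "fix_space (*v) (phase_group {1} w) = range (\<lambda>c. c *s w)"
proof -
  have "R \<in> phase_group {1} w" using assms by (auto simp: is_axis_def phase_group_def)
  then show ?thesis
    using assms by (auto simp: fix_space_def is_axis_def phase_group_def matrix_vector_smult)
qed

text \<open>\<open>g\<close> normalises the stabiliser of \<open>w\<close> exactly if
  \<open>g *v w\<close> has the same stabiliser. As \<open>R\<close> belongs to it and fixes only
  the line of \<open>w\<close>, this means that \<open>g\<close> preserves the line.\<close>

lemma normalizer_axis:
  assumes R: "is_axis R w"
  shows "normalizer octahedral_group (phase_group {1} w) = phase_group UNIV w"
proof -
  have w: "w \<noteq> 0" using R by (simp add: is_axis_def)
  have "phase_group {1} (g *v w) = phase_group {1} w \<longleftrightarrow> (\<exists>c. g *v w = c *s w)"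
    if g: "g \<in> carrier octahedral_group" for g
  proof
    assume *: "phase_group {1} (g *v w) = phase_group {1} w"
    have "R \<in> phase_group {1} w" using R by (auto simp: is_axis_def phase_group_def)
    then have "R *v (g *v w) = g *v w" unfolding *[symmetric] by (simp add: phase_group_def)
    then show "\<exists>c. g *v w = c *s w" using R by (auto simp: is_axis_def)
  next
    assume "\<exists>c. g *v w = c *s w"
    then obtain c where c: "g *v w = c *s w" ..
    then have "c \<noteq> 0" using norm_phase_octahedral[OF g c w] by auto
    then show "phase_group {1} (g *v w) = phase_group {1} w" by (simp add: c phase_group_smult)
  qed
  note iff = this
  have "phase_group {1} w \<subseteq> carrier octahedral_group" by (auto simp: phase_group_def)
  then have "normalizer octahedral_group (phase_group {1} w) =
      {g \<in> carrier octahedral_group. phase_group {1} (g *v w) = phase_group {1} w}"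
    by (simp add: normalizer_def stabilizer_def conj_coset_eq conj_phase_group cong: conj_cong)
  then show ?thesis by (simp add: iff phase_group_def[of UNIV] cong: conj_cong)
qed

lemma not_occurs_axis:
  assumes "is_axis R w"
  shows "\<not> occurs_at_primary_hopf octahedral_group (*v) (phase_group {1} w) (phase_group {1} w)"
proof -
  obtain n where n: "n \<in> carrier octahedral_group" "n *v w = - w" using assms by (auto simp: is_axis_def)
  have eq: "phase_group {1} w = {g \<in> carrier octahedral_group. g *v w = w}"
    by (simp add: phase_group_def)
  show ?thesis unfolding eq
  proof (rule not_occurs_on_line)
    fix i :: 3
    \<comment> \<open>The half turn about the \<open>i\<close>-th coordinate axis.\<close>
    define A :: "int triple triple" where "A = (if i = 1 then ((1,0,0),(0,-1,0),(0,0,-1))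
      else if i = 2 then ((-1,0,0),(0,1,0),(0,0,-1)) else ((-1,0,0),(0,-1,0),(0,0,1)))"
    have "A \<in> set octa" by (simp add: octa_eq A_def)
    moreover have "\<forall>z j. (tmat A *v z) $ j = (if j = i then z $ j else - (z $ j))"
      using exhaust_3[of i] by (elim disjE) (simp_all add: A_def forall_3 matrix_vector_mult_def sum_3)
    ultimately show "\<exists>g\<in>carrier octahedral_group. \<forall>z j. (g *v z) $ j = (if j = i then z $ j else - (z $ j))"
      unfolding carrier_octahedral by blast
  next
    fix i j :: 3
    \<comment> \<open>Powers of the cyclic shift. Indices are added modulo 3, so
      \<open>j = i + 1\<close> includes the step from 3 to 1.\<close>
    define A where "A = (if i = j then tI else if j = i + 1 then tC else tmm tC tC)"
    have "A \<in> set octa" by (simp add: octa_eq A_def tmm_simps)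
    moreover have "\<forall>z. (tmat A *v z) $ i = z $ j"
      using exhaust_3[of i] exhaust_3[of j]
      by (elim disjE) (simp_all add: A_def tmm_simps matrix_vector_mult_def sum_3)
    ultimately show "\<exists>g\<in>carrier octahedral_group. \<forall>z. (g *v z) $ i = z $ j"
      unfolding carrier_octahedral by blast
  next
    fix z assume *: "\<And>g. g \<in> {g \<in> carrier octahedral_group. g *v w = w} \<Longrightarrow> g *v z = z"
    show "\<exists>c. z = c *s w" using *[of R] assms by (auto simp: is_axis_def)
  qed (use assms n in \<open>auto simp: is_axis_def\<close>)
qed

text \<open>With H = K the quotient is trivial, and K fixes every point of Fix K, so it preserves
  any component.\<close>

lemma H_mod_K_conditions_axis:
  assumes R: "is_axis R w"
  shows "H_mod_K_conditions octahedral_group (*v) (phase_group {1} w) (phase_group {1} w)"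
proof -
  let ?K = "phase_group {1} w"
  interpret G: group octahedral_group by (rule group_octahedral)
  have w: "w \<noteq> 0" using R by (simp add: is_axis_def)
  have K: "subgroup ?K octahedral_group" by (rule subgroup_phase_group) (use w in auto)
  interpret K: group "octahedral_group\<lparr>carrier := ?K\<rparr>" by (rule G.subgroup_imp_group[OF K])
  have normal: "?K \<lhd> octahedral_group\<lparr>carrier := ?K\<rparr>"
  proof (rule K.normal_invI)
    show "subgroup ?K (octahedral_group\<lparr>carrier := ?K\<rparr>)" using K.subgroup_self by simp
    fix x h assume "x \<in> carrier (octahedral_group\<lparr>carrier := ?K\<rparr>)" "h \<in> ?K"
    then show "x \<otimes>\<^bsub>octahedral_group\<lparr>carrier := ?K\<rparr>\<^esub> h \<otimes>\<^bsub>octahedral_group\<lparr>carrier := ?K\<rparr>\<^esub>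
        inv\<^bsub>octahedral_group\<lparr>carrier := ?K\<rparr>\<^esub> x \<in> ?K"
      using K.m_closed[OF K.m_closed K.inv_closed, of x h x] by simp
  qed
  have "(octahedral_group\<lparr>carrier := ?K\<rparr>) Mod ?K \<cong> (octahedral_group\<lparr>carrier := ?K\<rparr>)\<lparr>carrier := {mat 1}\<rparr>"
    using K.self_factor_iso by (auto simp: is_iso_def)
  moreover have "trivial_group ((octahedral_group\<lparr>carrier := ?K\<rparr>)\<lparr>carrier := {mat 1}\<rparr>)"
    using K.subgroup_imp_group[OF K.triv_subgroup] by (simp add: trivial_group_def)
  ultimately have "cyclic_group ((octahedral_group\<lparr>carrier := ?K\<rparr>) Mod ?K)"
    using normal.factorgroup_is_group[OF normal]
    by (metis isomorphic_group_cyclicity trivial_group_def trivial_imp_cyclic_group)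
  moreover have "isotropy_subgroup octahedral_group (*v) ?K"
    by (auto simp: isotropy_subgroup_def stabilizer_def phase_group_def)
  moreover have "dim (fix_space (*v) ?K) = 2"
    unfolding fix_space_axis[OF R] using w by (rule dim_complex_line)
  moreover have "\<exists>V\<in>components (fix_space (*v) ?K - L_set octahedral_group (*v) ?K). \<forall>h\<in>?K. (*v) h ` V = V"
  proof -
    let ?U = "fix_space (*v) ?K - L_set octahedral_group (*v) ?K"
    \<comment> \<open>K is the whole stabiliser of \<open>w\<close>, so \<open>w\<close> avoids
      \<open>L_set\<close> and a component exists.\<close>
    have "w \<in> ?U" by (auto simp: fix_space_def L_set_def phase_group_def)
    then have "connected_component_set ?U w \<in> components ?U" by (rule componentsI)
    moreover have "(*v) h ` V = V" if "h \<in> ?K" "V \<subseteq> ?U" for h V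
    proof -
      have "h *v z = z" if "z \<in> V" for z using that \<open>h \<in> ?K\<close> \<open>V \<subseteq> ?U\<close> by (auto simp: fix_space_def)
      then show ?thesis by simp
    qed
    ultimately show ?thesis by (meson in_components_subset)
  qed
  ultimately show ?thesis unfolding H_mod_K_conditions_def using K normal by simp
qed

lemma is_axis_reps:
  "is_axis (tmat tR4) (tvec (1, 0, 0))" "is_axis (tmat tR4sq) (tvec (1, 0, 0))"
  "is_axis (tmat tC) (tvec (1, 1, 1))" "is_axis (tmat tR2) (tvec (0, 1, 1))"
proof -
  have rev: "\<exists>n\<in>carrier octahedral_group. n *v tvec (a, b, c) = - tvec (a, b, c)"
    if ex: "\<exists>A\<in>set octa. tmv A (a, b, c) = (- a, - b, - c)" for a b c
  proof -
    from ex obtain A where A: "A \<in> set octa" "tmv A (a, b, c) = (- a, - b, - c)" ..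
    have "tmat A *v tvec (a, b, c) = - tvec (a, b, c)"
      by (simp only: A flip: tvec_tmv) (simp add: vec_eq_iff forall_3)
    moreover have "tmat A \<in> carrier octahedral_group" unfolding carrier_octahedral using A(1) by (rule imageI)
    ultimately show ?thesis by blast
  qed
  have mem: "tR4 \<in> set octa" "tR4sq \<in> set octa" "tC \<in> set octa" "tR2 \<in> set octa"
    by (simp_all add: octa_eq rotation_defs)
  then have mem': "tmat tR4 \<in> carrier octahedral_group" "tmat tR4sq \<in> carrier octahedral_group"
    "tmat tC \<in> carrier octahedral_group" "tmat tR2 \<in> carrier octahedral_group"
    unfolding carrier_octahedral by blast+
  have eqs: "tmat tR4 *v z = vector [z $ 1, - z $ 3, z $ 2]" "tmat tR4sq *v z = vector [z $ 1, - z $ 2, - z $ 3]"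
    "tmat tC *v z = vector [z $ 2, z $ 3, z $ 1]" "tmat tR2 *v z = vector [- z $ 1, z $ 3, z $ 2]" for z
    by (simp_all add: rotation_defs vec_eq_iff forall_3 matrix_vector_mult_def sum_3)
  have neg: "a = - a \<longleftrightarrow> a = 0" "- a = a \<longleftrightarrow> a = 0" for a :: complex by auto
  have "\<exists>c. z = c *s tvec (1, 0, 0)" if "tmat tR4 *v z = z \<or> tmat tR4sq *v z = z" for z
  proof (rule exI[of _ "z $ 1"])
    have "z $ 2 = 0 \<and> z $ 3 = 0"
      using that
    proof
      assume *: "tmat tR4 *v z = z"
      have "- z $ 3 = z $ 2" "z $ 2 = z $ 3"
        using arg_cong[OF *, of "\<lambda>z. z $ 2"] arg_cong[OF *, of "\<lambda>z. z $ 3"] by (simp_all only: eqs vector_3)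
      then show ?thesis by (simp add: neg)
    next
      assume *: "tmat tR4sq *v z = z"
      have "- z $ 2 = z $ 2" "- z $ 3 = z $ 3"
        using arg_cong[OF *, of "\<lambda>z. z $ 2"] arg_cong[OF *, of "\<lambda>z. z $ 3"] by (simp_all only: eqs vector_3)
      then show ?thesis by (simp add: neg)
    qed
    then show "z = z $ 1 *s tvec (1, 0, 0)" by (simp add: vec_eq_iff forall_3)
  qed
  moreover have "\<exists>c. z = c *s tvec (1, 1, 1)" if "tmat tC *v z = z" for z
  proof (rule exI[of _ "z $ 1"])
    have "z $ 2 = z $ 1" "z $ 3 = z $ 2"
      using arg_cong[OF that, of "\<lambda>z. z $ 1"] arg_cong[OF that, of "\<lambda>z. z $ 2"] by (simp_all only: eqs vector_3)
    then show "z = z $ 1 *s tvec (1, 1, 1)" by (simp add: vec_eq_iff forall_3)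
  qed
  moreover have "\<exists>c. z = c *s tvec (0, 1, 1)" if "tmat tR2 *v z = z" for z
  proof (rule exI[of _ "z $ 2"])
    have "- z $ 1 = z $ 1" "z $ 3 = z $ 2"
      using arg_cong[OF that, of "\<lambda>z. z $ 1"] arg_cong[OF that, of "\<lambda>z. z $ 2"] by (simp_all only: eqs vector_3)
    then show "z = z $ 2 *s tvec (0, 1, 1)" by (simp add: vec_eq_iff forall_3 neg)
  qed
  moreover have "tvec (1, 0, 0) \<noteq> 0" "tvec (1, 1, 1) \<noteq> 0" "tvec (0, 1, 1) \<noteq> 0"
    by (auto simp: vec_eq_iff forall_3)
  moreover have "tmat tR4 *v tvec (1, 0, 0) = tvec (1, 0, 0)" "tmat tR4sq *v tvec (1, 0, 0) = tvec (1, 0, 0)"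
    "tmat tC *v tvec (1, 1, 1) = tvec (1, 1, 1)" "tmat tR2 *v tvec (0, 1, 1) = tvec (0, 1, 1)"
    by (simp_all add: eqs vec_eq_iff forall_3)
  ultimately show "is_axis (tmat tR4) (tvec (1, 0, 0))" "is_axis (tmat tR4sq) (tvec (1, 0, 0))"
    "is_axis (tmat tC) (tvec (1, 1, 1))" "is_axis (tmat tR2) (tvec (0, 1, 1))"
    unfolding is_axis_def using mem' rev[of 1 0 0] rev[of 1 1 1] rev[of 0 1 1] octa_reverses_axis
    by (simp_all del: tmat.simps tvec.simps)
qed

lemma generate_axis_eq:
  assumes "\<And>A. A \<in> S \<Longrightarrow> tmat A \<in> generate octahedral_group {tmat R}"
    and "{A \<in> set octa. tmv A u = u} = S" and "is_axis (tmat R) (tvec u)"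
  shows "generate octahedral_group {tmat R} = phase_group {1} (tvec u)"
proof
  show "generate octahedral_group {tmat R} \<subseteq> phase_group {1} (tvec u)"
    using assms(3)
    by (intro group.generate_subgroup_incl[OF group_octahedral] subgroup_phase_group)
      (auto simp: is_axis_def phase_group_def)
  show "phase_group {1} (tvec u) \<subseteq> generate octahedral_group {tmat R}"
    unfolding phase_group_tvec using assms(1,2) by blast
qed

text \<open>\<open>tR4sq\<close> has no counterpart here: the stabiliser of its axis vector also
  contains the quarter turns.\<close>

lemma generate_reps:
  "generate octahedral_group {tmat tR4} = phase_group {1} (tvec (1, 0, 0))"
  "generate octahedral_group {tmat tC} = phase_group {1} (tvec (1, 1, 1))"
  "generate octahedral_group {tmat tR2} = phase_group {1} (tvec (0, 1, 1))"
proof -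
  have id: "tmat tI \<in> generate octahedral_group {g}" for g
    using generate.one[of octahedral_group "{g}"] by (simp add: tmat_tI)
  have incl: "g \<in> generate octahedral_group {g}" for g
    by (rule generate.incl) simp
  have mult: "tmat (tmm A B) \<in> generate octahedral_group {g}"
    if "tmat A \<in> generate octahedral_group {g}" "tmat B \<in> generate octahedral_group {g}" for A B g
    using generate.eng[OF that] by (simp add: tmat_tmm)
  have sq: "tR4sq = tmm tR4 tR4" by (simp add: tmm_simps rotation_defs)
  show "generate octahedral_group {tmat tR4} = phase_group {1} (tvec (1, 0, 0))"
    by (rule generate_axis_eq[OF _ octa_stabilizers(1) is_axis_reps(1)], elim insertE emptyE)
      (simp_all only: sq id incl mult)
  show "generate octahedral_group {tmat tC} = phase_group {1} (tvec (1, 1, 1))"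
    by (rule generate_axis_eq[OF _ octa_stabilizers(2) is_axis_reps(3)], elim insertE emptyE)
      (simp_all only: id incl mult)
  show "generate octahedral_group {tmat tR2} = phase_group {1} (tvec (0, 1, 1))"
    by (rule generate_axis_eq[OF _ octa_stabilizers(3) is_axis_reps(4)], elim insertE emptyE)
      (simp_all only: id incl)
qed

lemma card_generate_reps:
  "card (generate octahedral_group {tmat tR4}) = 4"
  "card (generate octahedral_group {tmat tC}) = 3"
  "card (generate octahedral_group {tmat tR2}) = 2"
  unfolding generate_reps phase_group_tvec octa_stabilizers
  by (subst card_image[OF inj_on_subset[OF inj_tmat]]; simp add: tmm_simps rotation_defs)+

lemma conj_generate:
  assumes g: "g \<in> carrier octahedral_group" and R: "R \<in> carrier octahedral_group"
  shows "(\<lambda>h. g ** h ** inv\<^bsub>octahedral_group\<^esub> g) ` generate octahedral_group {R} =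
    generate octahedral_group {g ** R ** inv\<^bsub>octahedral_group\<^esub> g}"
proof -
  let ?c = "\<lambda>h. g ** h ** inv\<^bsub>octahedral_group\<^esub> g"
  have "?c (a ** b) = ?c a ** ?c b" for a b
  proof -
    have "?c a ** ?c b = g ** a ** (inv\<^bsub>octahedral_group\<^esub> g ** g) ** b ** inv\<^bsub>octahedral_group\<^esub> g"
      by (simp only: matrix_mul_assoc)
    then show ?thesis using g by (simp add: inv_octahedral matrix_mul_assoc)
  qed
  then have "group_hom octahedral_group octahedral_group ?c"
    using group_octahedral g
    by (auto simp: group_hom_def group_hom_axioms_def hom_def mult_closed_octahedral inv_octahedral)
  from group_hom.generate_img[OF this, of "{R}"] R show ?thesis by simp
qed

section \<open>Circular orbits with trivial spatial symmetry\<close>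

definition is_circular :: "complex^3^3 \<Rightarrow> complex^3 \<Rightarrow> bool" where
  "is_circular R v \<longleftrightarrow> R \<in> carrier octahedral_group \<and> v \<noteq> 0 \<and>
     phase_group UNIV v = generate octahedral_group {R} \<and> phase_group {1} v = {mat 1}"

lemma is_circular_conj:
  assumes g: "g \<in> carrier octahedral_group" and R: "is_circular R v"
  shows "is_circular (g ** R ** inv\<^bsub>octahedral_group\<^esub> g) (g *v v)"
proof -
  have R': "R \<in> carrier octahedral_group" "v \<noteq> 0" "phase_group UNIV v = generate octahedral_group {R}"
    "phase_group {1} v = {mat 1}"
    using R by (simp_all add: is_circular_def)
  have "g *v v \<noteq> 0" using R'(2) norm_octahedral[OF g, of v] by auto
  moreover have "g ** R ** inv\<^bsub>octahedral_group\<^esub> g \<in> carrier octahedral_group"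
    using g R'(1) by (intro mult_closed_octahedral inv_octahedral)
  ultimately show ?thesis
    unfolding is_circular_def conj_phase_group[OF g, symmetric] conj_generate[OF g R'(1), symmetric] R'(3,4)
    by (simp add: g inv_octahedral)
qed

text \<open>An element moving \<open>v\<close> by a phase fixes the normal
  \<open>plane_axis v\<close>, a nonzero multiple of \<open>tvec u\<close>, so it comes from the
  small set \<open>S\<close>. Hence \<open>free\<close> and \<open>gen\<close> are checked on
  \<open>S\<close> only.\<close>

lemma is_circularI:
  assumes R: "R \<in> set octa" and v: "v \<noteq> 0" "tmat R *v v = c *s v"
    and axis: "plane_axis v = k *s tvec u" "k \<noteq> 0"
    and S: "{A \<in> set octa. tmv A u = u} = S"
    and free: "\<And>A. A \<in> S \<Longrightarrow> A \<noteq> tI \<Longrightarrow> tmat A *v v \<noteq> v"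
    and gen: "\<And>A. A \<in> S \<Longrightarrow> tmat A \<notin> generate octahedral_group {tmat R} \<Longrightarrow> \<nexists>c. tmat A *v v = c *s v"
  shows "is_circular (tmat R) v"
proof -
  have in_S: "\<exists>A\<in>S. h = tmat A" if h_in: "h \<in> phase_group UNIV v" for h
  proof -
    obtain c where h: "h \<in> carrier octahedral_group" "h *v v = c *s v"
      using h_in by (auto simp: phase_group_def)
    have "h *v plane_axis v = plane_axis v" by (rule phase_fixes_plane_axis[OF h v(1)])
    then have "k *s (h *v tvec u) = k *s tvec u" by (simp add: axis(1) matrix_vector_smult)
    then have "h *v tvec u = tvec u" using axis(2) by (simp add: vec_eq_iff)
    then have "h \<in> phase_group {1} (tvec u)" using h by (simp add: phase_group_def)
    then show ?thesis unfolding phase_group_tvec S by blast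
  qed
  have R': "tmat R \<in> carrier octahedral_group" using R unfolding carrier_octahedral by (rule imageI)
  have "generate octahedral_group {tmat R} \<subseteq> phase_group UNIV v"
    using v R' by (intro group.generate_subgroup_incl[OF group_octahedral] subgroup_phase_group)
      (auto simp: phase_group_def)
  moreover have "phase_group UNIV v \<subseteq> generate octahedral_group {tmat R}"
  proof
    fix h assume h: "h \<in> phase_group UNIV v"
    then obtain A where A: "A \<in> S" "h = tmat A" using in_S by blast
    show "h \<in> generate octahedral_group {tmat R}"
      using gen[OF A(1)] h A(2) by (auto simp: phase_group_def)
  qed
  moreover have "h \<in> {mat 1}" if h: "h \<in> phase_group {1} v" for h
  proof -
    have "h \<in> phase_group UNIV v" using h unfolding phase_group_def by blast
    moreover have "h *v v = v" using h by (simp add: phase_group_def)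
    ultimately have "h \<in> phase_group UNIV v" "h *v v = v" by blast+
    then obtain A where "A \<in> S" "h = tmat A" using in_S by blast
    then show ?thesis using free[of A] \<open>h *v v = v\<close> tmat_tI by (metis singletonI)
  qed
  moreover have "mat 1 \<in> phase_group {1} v"
    using subgroup.one_closed[OF subgroup_phase_group[OF v(1), of "{1}"]] by simp
  ultimately show ?thesis
    unfolding is_circular_def using R' v(1) by (intro conjI equalityI) (assumption | blast)+
qed
lemma is_circular_reps:
  "\<exists>v. is_circular (tmat tR4) v" "\<exists>v. is_circular (tmat tR4sq) v"
  "\<exists>v. is_circular (tmat tC) v" "\<exists>v. is_circular (tmat tR2) v"
proof -
  have mem: "tR4 \<in> set octa" "tR4sq \<in> set octa" "tC \<in> set octa" "tR2 \<in> set octa"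
    by (simp_all add: octa_eq rotation_defs)
  have eqs: "tmat tR4 *v z = vector [z $ 1, - z $ 3, z $ 2]" "tmat tR4sq *v z = vector [z $ 1, - z $ 2, - z $ 3]"
    "tmat (tmm tR4 tR4sq) *v z = vector [z $ 1, z $ 3, - z $ 2]"
    "tmat tC *v z = vector [z $ 2, z $ 3, z $ 1]" "tmat (tmm tC tC) *v z = vector [z $ 3, z $ 1, z $ 2]"
    "tmat tR2 *v z = vector [- z $ 1, z $ 3, z $ 2]" for z
    by (simp_all add: tmm_simps rotation_defs vec_eq_iff forall_3 matrix_vector_mult_def sum_3)
  have gen: "tmat A \<in> generate octahedral_group {tmat R}"
    if "A \<in> S" "{A \<in> set octa. tmv A u = u} = S"
      "generate octahedral_group {tmat R} = phase_group {1} (tvec u)" for A R S u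
    using that phase_group_tvec by blast
  show "\<exists>v. is_circular (tmat tR4) v"
  \<comment> \<open>An eigenvector of the quarter turn orthogonal to its axis; the eigenvalue
    \<open>- \<i>\<close> has order 4, so no nontrivial power fixes the vector.\<close>
  proof (rule exI[of _ "vector [0, 1, \<i>]"], rule is_circularI[OF mem(1) _ _ _ _ octa_stabilizers(1)])
    show "tmat tR4 *v vector [0, 1, \<i>] = (- \<i>) *s vector [0, 1, \<i>]"
      "plane_axis (vector [0, 1, \<i>]) = (2 * \<i>) *s tvec (1, 0, 0)"
      by (simp_all add: eqs plane_axis_def vec_eq_iff forall_3)
    fix A assume A: "A \<in> {tI, tR4, tmm tR4 tR4sq, tR4sq}"
    show "tmat A *v vector [0, 1, \<i>] \<noteq> vector [0, 1, \<i>]" if "A \<noteq> tI"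
      using A that by (elim insertE emptyE) (simp_all add: eqs vec_eq_iff forall_3 complex_eq_iff del: tmat.simps)
    show "\<nexists>c. tmat A *v vector [0, 1, \<i>] = c *s vector [0, 1, \<i>]"
      if "tmat A \<notin> generate octahedral_group {tmat tR4}"
      using that gen[OF A octa_stabilizers(1) generate_reps(1)] by simp
  qed (simp_all add: vec_eq_iff forall_3)
  show "\<exists>v. is_circular (tmat tR4sq) v"
  \<comment> \<open>The half turn is -1 on the whole orthogonal plane. The factor 2 turns the circle
    into an ellipse, which a quarter turn does not preserve, so H stays of order 2.\<close>
  proof (rule exI[of _ "vector [0, 1, 2 * \<i>]"], rule is_circularI[OF mem(2) _ _ _ _ octa_stabilizers(1)])
    show "tmat tR4sq *v vector [0, 1, 2 * \<i>] = (- 1) *s vector [0, 1, 2 * \<i>]"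
      "plane_axis (vector [0, 1, 2 * \<i>]) = (4 * \<i>) *s tvec (1, 0, 0)"
      by (simp_all add: eqs plane_axis_def vec_eq_iff forall_3)
    fix A assume A: "A \<in> {tI, tR4, tmm tR4 tR4sq, tR4sq}"
    show "tmat A *v vector [0, 1, 2 * \<i>] \<noteq> vector [0, 1, 2 * \<i>]" if "A \<noteq> tI"
      using A that by (elim insertE emptyE) (simp_all add: eqs vec_eq_iff forall_3 complex_eq_iff del: tmat.simps)
    have "tmat tI \<in> generate octahedral_group {tmat tR4sq}" "tmat tR4sq \<in> generate octahedral_group {tmat tR4sq}"
      using generate.one[of octahedral_group "{tmat tR4sq}"] generate.incl[of "tmat tR4sq" "{tmat tR4sq}"]
      by (simp_all add: tmat_tI del: tmat.simps)
    then show "\<nexists>c. tmat A *v vector [0, 1, 2 * \<i>] = c *s vector [0, 1, 2 * \<i>]"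
      if "tmat A \<notin> generate octahedral_group {tmat tR4sq}"
      using A that by (elim insertE emptyE) (auto simp: eqs vec_eq_iff forall_3 complex_eq_iff simp del: tmat.simps)
  qed (simp_all add: vec_eq_iff forall_3)
  \<comment> \<open>A primitive cube root of unity;
    \<open>vector [1, \<omega>, cnj \<omega>]\<close> is an eigenvector of the cyclic shift for it,
    orthogonal to the diagonal.\<close>
  define \<omega> where "\<omega> = Complex (- 1 / 2) (sqrt 3 / 2)"
  show "\<exists>v. is_circular (tmat tC) v"
  proof (rule exI[of _ "vector [1, \<omega>, cnj \<omega>]"], rule is_circularI[OF mem(3) _ _ _ _ octa_stabilizers(2)])
    show "tmat tC *v vector [1, \<omega>, cnj \<omega>] = \<omega> *s vector [1, \<omega>, cnj \<omega>]"
      "plane_axis (vector [1, \<omega>, cnj \<omega>]) = Complex 0 (sqrt 3) *s tvec (1, 1, 1)"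
      by (simp_all add: eqs plane_axis_def vec_eq_iff forall_3 complex_eq_iff \<omega>_def)
    fix A assume A: "A \<in> {tI, tC, tmm tC tC}"
    show "tmat A *v vector [1, \<omega>, cnj \<omega>] \<noteq> vector [1, \<omega>, cnj \<omega>]" if "A \<noteq> tI"
      using A that by (elim insertE emptyE) (simp_all add: eqs vec_eq_iff forall_3 complex_eq_iff \<omega>_def del: tmat.simps)
    show "\<nexists>c. tmat A *v vector [1, \<omega>, cnj \<omega>] = c *s vector [1, \<omega>, cnj \<omega>]"
      if "tmat A \<notin> generate octahedral_group {tmat tC}"
      using that gen[OF A octa_stabilizers(2) generate_reps(2)] by simp
  qed (simp_all add: vec_eq_iff forall_3 complex_eq_iff)
  show "\<exists>v. is_circular (tmat tR2) v"
  \<comment> \<open>The real part (0, 1, -1) and the imaginary part (1, 0, 0) span the plane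
    orthogonal to the edge axis, where the half turn is -1.\<close>
  proof (rule exI[of _ "vector [\<i>, 1, - 1]"], rule is_circularI[OF mem(4) _ _ _ _ octa_stabilizers(3)])
    show "tmat tR2 *v vector [\<i>, 1, - 1] = (- 1) *s vector [\<i>, 1, - 1]"
      "plane_axis (vector [\<i>, 1, - 1]) = (- 2 * \<i>) *s tvec (0, 1, 1)"
      by (simp_all add: eqs plane_axis_def vec_eq_iff forall_3)
    fix A assume A: "A \<in> {tI, tR2}"
    show "tmat A *v vector [\<i>, 1, - 1] \<noteq> vector [\<i>, 1, - 1]" if "A \<noteq> tI"
      using A that by (elim insertE emptyE) (simp_all add: eqs vec_eq_iff forall_3 complex_eq_iff del: tmat.simps)
    show "\<nexists>c. tmat A *v vector [\<i>, 1, - 1] = c *s vector [\<i>, 1, - 1]"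
      if "tmat A \<notin> generate octahedral_group {tmat tR2}"
      using that gen[OF A octa_stabilizers(3) generate_reps(3)] by simp
  qed (simp_all add: vec_eq_iff forall_3)
qed

section \<open>Classification of the pairs\<close>

lemma octahedral_conjugacy:
  assumes "h \<in> carrier octahedral_group" "h \<noteq> mat 1"
  obtains g R where "g \<in> carrier octahedral_group" "R \<in> {tR4, tR4sq, tC, tR2}"
    "h = g ** tmat R ** inv\<^bsub>octahedral_group\<^esub> g"
proof -
  obtain A where A: "A \<in> set octa" "h = tmat A" using assms(1) unfolding carrier_octahedral by blast
  have "A \<noteq> tI" using A assms(2) tmat_tI by metis
  from octa_conjugacy[OF A(1) this]
  obtain B R where B: "B \<in> set octa" "R \<in> {tR4, tR4sq, tC, tR2}" "tmm A B = tmm B R" .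
  have g: "tmat B \<in> carrier octahedral_group" using B(1) unfolding carrier_octahedral by blast
  have "h ** tmat B = tmat B ** tmat R" using B(3) by (simp add: A flip: tmat_tmm)
  then have "h ** (tmat B ** inv\<^bsub>octahedral_group\<^esub> tmat B) = tmat B ** tmat R ** inv\<^bsub>octahedral_group\<^esub> tmat B"
    by (metis matrix_mul_assoc)
  then have "h = tmat B ** tmat R ** inv\<^bsub>octahedral_group\<^esub> tmat B"
    using inv_octahedral(3)[OF g] by simp
  with g B(2) show thesis using that by blast
qed

text \<open>Dividing by the trivial subgroup changes H only up to isomorphism, so condition (a) for
  trivial K says that H itself is cyclic.\<close>

lemma cyclic_subgroup_generator:
  assumes H: "subgroup H octahedral_group"
    and cyclic: "cyclic_group (octahedral_group\<lparr>carrier := H\<rparr> Mod {mat 1})"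
  obtains h where "h \<in> H" "H = generate octahedral_group {h}"
proof -
  let ?H = "octahedral_group\<lparr>carrier := H\<rparr>"
  interpret G: group octahedral_group by (rule group_octahedral)
  interpret H: group ?H by (rule G.subgroup_imp_group[OF H])
  have "?H Mod {\<one>\<^bsub>?H\<^esub>} \<cong> ?H" using H.trivial_factor_iso by (auto simp: is_iso_def)
  moreover have "group (?H Mod {\<one>\<^bsub>?H\<^esub>})" by (rule normal.factorgroup_is_group[OF H.one_is_normal])
  ultimately have "cyclic_group ?H"
    using isomorphic_group_cyclicity[of "?H Mod {\<one>\<^bsub>?H\<^esub>}" ?H] H.is_group cyclic by simp
  then obtain h where h: "h \<in> H" "subgroup_generated ?H {h} = ?H"
    by (auto simp: cyclic_group_def)
  from arg_cong[OF h(2), of carrier] have "generate ?H {h} = H"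
    using h(1) by (simp add: carrier_subgroup_generated)
  moreover have "generate ?H {h} = generate octahedral_group {h}"
    using h(1) by (intro G.generate_consistent H) simp
  ultimately show thesis using h(1) that by blast
qed

text \<open>A nontrivial \<open>h\<close> in K confines the point whose stabiliser is K to the axis
  of \<open>h\<close>. The point is nonzero: otherwise K would be the whole group, whose fixed space
  is 0 because some element reverses the axis.\<close>

lemma isotropy_classification:
  assumes iso: "isotropy_subgroup octahedral_group (*v) K" and dim: "2 \<le> dim (fix_space (*v) K)"
    and K: "K \<noteq> {mat 1}"
  obtains g R u where "g \<in> carrier octahedral_group"
    "(R, u) \<in> {(tR4, (1, 0, 0)), (tC, (1, 1, 1)), (tR2, (0, 1, 1))}"
    "K = phase_group {1} (g *v tvec u)"
proof -
  obtain z where z: "K = {h \<in> carrier octahedral_group. h *v z = z}"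
    using iso by (auto simp: isotropy_subgroup_def stabilizer_def)
  have "mat 1 \<in> carrier octahedral_group"
    by (metis group_octahedral group.is_monoid monoid.one_closed one_octahedral)
  then have "mat 1 \<in> K" by (simp add: z)
  with K obtain h where h: "h \<in> K" "h \<noteq> mat 1" by blast
  then have h': "h \<in> carrier octahedral_group" "h *v z = z" by (auto simp: z)
  obtain g R where g: "g \<in> carrier octahedral_group" and R: "R \<in> {tR4, tR4sq, tC, tR2}"
    and hR: "h = g ** tmat R ** inv\<^bsub>octahedral_group\<^esub> g"
    by (rule octahedral_conjugacy[OF h'(1) h(2)])
  \<comment> \<open>For \<open>R = tR4sq\<close> the partner \<open>R'\<close> is
    \<open>tR4\<close>: the axis is the same, but the quarter turn generates the stabiliser.\<close>
  from R is_axis_reps obtain R' and u :: "int triple"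
    where u: "(R', u) \<in> {(tR4, (1, 0, 0)), (tC, (1, 1, 1)), (tR2, (0, 1, 1))}" and axis: "is_axis (tmat R) (tvec u)"
    by blast
  have "is_axis h (g *v tvec u)" unfolding hR by (rule is_axis_conj[OF g axis])
  then obtain n where w: "\<And>y. h *v y = y \<Longrightarrow> \<exists>c. y = c *s (g *v tvec u)"
    and n: "n \<in> carrier octahedral_group" "n *v (g *v tvec u) = - (g *v tvec u)"
    unfolding is_axis_def by blast
  obtain c where c: "z = c *s (g *v tvec u)" using w h'(2) by blast
  have "c \<noteq> 0"
  proof
    assume "c = 0"
    then have "K = carrier octahedral_group" by (simp add: z c)
    have "fix_space (*v) K \<subseteq> {0}"
    proof
      fix y assume y: "y \<in> fix_space (*v) K"
      then obtain d where d: "y = d *s (g *v tvec u)" using w h(1) by (auto simp: fix_space_def)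
      have "n *v y = y" using y n(1) \<open>K = carrier octahedral_group\<close> by (auto simp: fix_space_def)
      then have "- y = y" by (simp add: d matrix_vector_smult n vec_eq_iff)
      then show "y \<in> {0}" by (simp add: vec_eq_iff)
    qed
    then have "dim (fix_space (*v) K) = 0" by (simp only: dim_eq_0)
    with dim show False by linarith
  qed
  have "K = phase_group {1} z" by (simp add: z phase_group_def)
  also have "\<dots> = phase_group {1} (g *v tvec u)" unfolding c by (rule phase_group_smult[OF \<open>c \<noteq> 0\<close>])
  finally show thesis by (rule that[OF g u])
qed

lemma occurs_phase_group:
  assumes "v \<noteq> 0"
  shows "occurs_at_primary_hopf octahedral_group (*v) (phase_group UNIV v) (phase_group {1} v)"
  using occurs_circular[OF norm_octahedral assms, of octahedral_group] by (simp add: phase_group_def)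

lemma is_axis_generate_reps:
  assumes "(R, u) \<in> {(tR4, (1, 0, 0)), (tC, (1, 1, 1)), (tR2, (0, 1, 1))}"
  shows "is_axis (tmat R) (tvec u)" "generate octahedral_group {tmat R} = phase_group {1} (tvec u)"
  using assms is_axis_reps generate_reps by blast+

text \<open>For nontrivial K the fixed space has dimension 2, so condition (c), with the exceptional
  H = K excluded, leaves the normaliser; it is the phase group of the axis vector.\<close>

lemma occurs_or_exceptional:
  assumes cond: "H_mod_K_conditions octahedral_group (*v) H K" and H: "H \<noteq> {mat 1}"
    and "\<not> (\<exists>R\<in>{tR4, tC, tR2}. \<exists>g\<in>carrier octahedral_group.
      H = (\<lambda>h. g ** h ** inv\<^bsub>octahedral_group\<^esub> g) ` generate octahedral_group {tmat R} \<and>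
      K = (\<lambda>h. g ** h ** inv\<^bsub>octahedral_group\<^esub> g) ` generate octahedral_group {tmat R})"
  shows "occurs_at_primary_hopf octahedral_group (*v) H K"
proof (cases "K = {mat 1}")
  case True
  have sub: "subgroup H octahedral_group" "cyclic_group (octahedral_group\<lparr>carrier := H\<rparr> Mod {mat 1})"
    using cond True by (auto simp: H_mod_K_conditions_def)
  obtain h where h: "h \<in> H" "H = generate octahedral_group {h}"
    by (rule cyclic_subgroup_generator[OF sub])
  have "h \<in> carrier octahedral_group" using h(1) sub(1) subgroup.subset by blast
  moreover have "h \<noteq> mat 1"
    using H h(2) group.generate_one[OF group_octahedral] by auto
  ultimately obtain g R where g: "g \<in> carrier octahedral_group" and R: "R \<in> {tR4, tR4sq, tC, tR2}"
    and hR: "h = g ** tmat R ** inv\<^bsub>octahedral_group\<^esub> g"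
    by (rule octahedral_conjugacy)
  obtain v where "is_circular (tmat R) v" using R is_circular_reps by blast
  then have "is_circular h (g *v v)" unfolding hR by (rule is_circular_conj[OF g])
  then show ?thesis
    using occurs_phase_group[of "g *v v"] by (simp add: is_circular_def h(2)[symmetric] True)
next
  case False
  have iso: "isotropy_subgroup octahedral_group (*v) K" "2 \<le> dim (fix_space (*v) K)"
    and HK: "dim (fix_space (*v) K) = 2 \<Longrightarrow> H = K \<or> H = normalizer octahedral_group K"
    using cond by (auto simp: H_mod_K_conditions_def)
  obtain g R u where g: "g \<in> carrier octahedral_group"
    and Ru: "(R, u) \<in> {(tR4, (1, 0, 0)), (tC, (1, 1, 1)), (tR2, (0, 1, 1))}"
    and K: "K = phase_group {1} (g *v tvec u)"
    by (rule isotropy_classification[OF iso False])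
  let ?w = "g *v tvec u"
  have axis: "is_axis (g ** tmat R ** inv\<^bsub>octahedral_group\<^esub> g) ?w"
    using is_axis_generate_reps(1)[OF Ru] by (rule is_axis_conj[OF g])
  then have "?w \<noteq> 0" by (simp add: is_axis_def)
  have "dim (fix_space (*v) K) = 2"
    unfolding K fix_space_axis[OF axis] by (rule dim_complex_line[OF \<open>?w \<noteq> 0\<close>])
  moreover have "K = (\<lambda>h. g ** h ** inv\<^bsub>octahedral_group\<^esub> g) ` generate octahedral_group {tmat R}"
    unfolding is_axis_generate_reps(2)[OF Ru] conj_phase_group[OF g] by (rule K)
  moreover have "R \<in> {tR4, tC, tR2}" using Ru by blast
  ultimately have "H = normalizer octahedral_group K" using HK g assms(3) by blast
  then have "H = phase_group UNIV ?w" unfolding K normalizer_axis[OF axis] .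
  then show ?thesis using occurs_phase_group[OF \<open>?w \<noteq> 0\<close>] K by simp
qed

lemma conj_exceptional_not_occurs:
  assumes "R \<in> {tR4, tC, tR2}" and g: "g \<in> carrier octahedral_group"
    and "H = (\<lambda>h. g ** h ** inv\<^bsub>octahedral_group\<^esub> g) ` generate octahedral_group {tmat R}"
  shows "\<not> occurs_at_primary_hopf octahedral_group (*v) H H"
proof -
  obtain u :: "int triple" where u: "(R, u) \<in> {(tR4, (1, 0, 0)), (tC, (1, 1, 1)), (tR2, (0, 1, 1))}"
    using assms(1) by blast
  have "H = phase_group {1} (g *v tvec u)"
    unfolding assms(3) is_axis_generate_reps(2)[OF u] by (rule conj_phase_group[OF g])
  then show ?thesis
    using not_occurs_axis[OF is_axis_conj[OF g is_axis_generate_reps(1)[OF u]]] by simp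
qed

text \<open>The class representatives were chosen to be the generators named in the theorem, so no
  conjugation is left to carry out here.\<close>

lemma generators_eq:
  "T_mat ** C_mat ** C_mat = tmat tR4" "T_mat ** T_mat ** T_mat ** C_mat ** C_mat = tmat tR2"
  unfolding tmat_tC[symmetric] tmat_tT[symmetric] tmat_tmm[symmetric]
  by (rule arg_cong[where f = tmat], simp add: tmm_simps rotation_defs)+

text \<open>The exceptions are shown to satisfy the conditions, so they are genuine; the equivalence
  then covers every conjugate of them as well as all other pairs.\<close>

theorem proposition2:
  shows "let G = octahedral_group;
             Z4 = generate G {T_mat ** C_mat ** C_mat};
             Z3 = generate G {C_mat};
             Z2 = generate G {T_mat ** T_mat ** T_mat ** C_mat ** C_mat}
         in card (carrier G) = 24 \<and> card Z4 = 4 \<and> card Z3 = 3 \<and> card Z2 = 2 \<and>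
            (\<forall>E\<in>{Z4, Z3, Z2}.
               H_mod_K_conditions G (*v) E E \<and> \<not> occurs_at_primary_hopf G (*v) E E) \<and>
            (\<forall>H K. H_mod_K_conditions G (*v) H K \<and> H \<noteq> {\<one>\<^bsub>G\<^esub>} \<longrightarrow>
               (occurs_at_primary_hopf G (*v) H K \<longleftrightarrow>
                  \<not> (\<exists>E\<in>{Z4, Z3, Z2}. conjugate_pairs G E E H K)))"
proof -
  let ?E = "\<lambda>R. generate octahedral_group {tmat R}"
  have eqs: "{?E tR4, ?E tC, ?E tR2} = ?E ` {tR4, tC, tR2}" by simp
  have exceptional: "H_mod_K_conditions octahedral_group (*v) E E \<and>
      \<not> occurs_at_primary_hopf octahedral_group (*v) E E"
    if "E \<in> {?E tR4, ?E tC, ?E tR2}" for E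
  proof -
    have "E = phase_group {1} (tvec (1, 0, 0)) \<or> E = phase_group {1} (tvec (1, 1, 1)) \<or>
        E = phase_group {1} (tvec (0, 1, 1))"
      using that unfolding generate_reps by blast
    then show ?thesis
      using is_axis_reps[THEN H_mod_K_conditions_axis] is_axis_reps[THEN not_occurs_axis] by blast
  qed
  have main: "occurs_at_primary_hopf octahedral_group (*v) H K \<longleftrightarrow>
      \<not> (\<exists>E\<in>{?E tR4, ?E tC, ?E tR2}. conjugate_pairs octahedral_group E E H K)"
    if cond: "H_mod_K_conditions octahedral_group (*v) H K" "H \<noteq> {mat 1}" for H K
  proof
    assume occ: "occurs_at_primary_hopf octahedral_group (*v) H K"
    show "\<not> (\<exists>E\<in>{?E tR4, ?E tC, ?E tR2}. conjugate_pairs octahedral_group E E H K)"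
    proof
      assume "\<exists>E\<in>{?E tR4, ?E tC, ?E tR2}. conjugate_pairs octahedral_group E E H K"
      then obtain R g where R: "R \<in> {tR4, tC, tR2}" and g: "g \<in> carrier octahedral_group"
        and HK: "H = (\<lambda>h. g ** h ** inv\<^bsub>octahedral_group\<^esub> g) ` ?E R"
          "K = (\<lambda>h. g ** h ** inv\<^bsub>octahedral_group\<^esub> g) ` ?E R"
        unfolding eqs conjugate_pairs_def conj_coset_eq by blast
      then show False using conj_exceptional_not_occurs[OF R g HK(1)] occ by simp
    qed
  next
    assume no: "\<not> (\<exists>E\<in>{?E tR4, ?E tC, ?E tR2}. conjugate_pairs octahedral_group E E H K)"
    show "occurs_at_primary_hopf octahedral_group (*v) H K"
      using cond no unfolding eqs conjugate_pairs_def conj_coset_eq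
      by (intro occurs_or_exceptional) blast+
  qed
  show ?thesis
    unfolding Let_def generators_eq one_octahedral
    unfolding tmat_tC[symmetric]
    by (intro conjI ballI allI impI, rule card_octahedral, (rule card_generate_reps)+,
        erule exceptional[THEN conjunct1], erule exceptional[THEN conjunct2],
        rule main, erule conjunct1, erule conjunct2)
qed

end
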